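(* There exists an absolute constant $C_0>0$ such that the following holds. Let $\mathbf A$ be the adjacency matrix of a graph drawn from the degree-corrected stochastic block model on $n$ nodes with $r$ clusters $C_1^*,\dots,C_r^*$, degree heterogeneity parameters $\boldsymbol\theta$ and connectivity matrix $\mathbf B$. Assume that the degree-corrected density gap condition $$\max_{1\le a<b\le r}\frac{B_{ab}}{H_aH_b}<\min_{1\le a\le r}\frac{B_{aa}}{H_a^2}$$ holds, and moreover that the tuning parameter $\lambda$ satisfies, for some number $\delta>0$, $$\max_{1\le a<b\le r}\frac{B_{ab}+\delta}{H_aH_b}<\lambda<\min_{1\le a\le r}\frac{B_{aa}-\delta}{H_a^2}.$$ Then with probability at least $0.99-2(e/2)^{-2n}$, the solution $\widehat{\mathbf Y}$ of the convex program $$\max_{\mathbf Y}\ \langle \mathbf Y,\ \mathbf A-\lambda \mathbf d\mathbf d^\top\rangle\quad\text{subject to}\quad \mathbf Y\succeq 0,\quad 0\le Y_{ij}\le 1\ \ \forall i,j\in[n],\quad Y_{ii}=1\ \ \forall i\in[n]$$ satisfies $$\|\mathbf Y^*-\widehat{\mathbf Y}\|_{1,\boldsymbol\theta}\le \frac{C_0}{\delta}\left(1+\Big(\min_{1\le a\le r}\frac{B_{aa}}{H_a^2}\Big)\|\mathbf f\|_1\right)\left(\sqrt{n\|\mathbf f\|_1}+n\right).$$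
   Context: Degree-corrected stochastic block model (DCSBM): the node set $[n]=\{1,\dots,n\}$ is partitioned into $r$ fixed but unknown clusters $C_1^*,\dots,C_r^*$. There are a vector $\boldsymbol\theta=(\theta_1,\dots,\theta_n)^\top$ with nonnegative entries (the degree heterogeneity parameters), normalized so that $\max_i\theta_i=1$, and a symmetric $r\times r$ matrix $\mathbf B$ with nonnegative entries (the connectivity matrix). Each pair of distinct nodes $i\in C_a^*$, $j\in C_b^*$ is joined by an undirected edge with probability $\theta_i\theta_jB_{ab}\in[0,1]$, independently of all other pairs. $\mathbf A\in\{0,1\}^{n\times n}$ is the adjacency matrix (symmetric, zero diagonal), $d_i=\sum_{j}A_{ij}$ is the degree of node $i$, and $\mathbf d=(d_1,\dots,d_n)^\top$. The true partition matrix $\mathbf Y^*\in\{0,1\}^{n\times n}$ has $Y^*_{ij}=1$ if and only if $i$ and $j$ lie in the same cluster (in particular $Y^*_{ii}=1$). For $1\le a\le r$: $G_a=\sum_{i\in C_a^*}\theta_i$ and $H_a=\sum_{b=1}^rB_{ab}G_b$. The vector $\mathbf f\in\mathbb R^n$ has $f_i=\theta_iH_a$ for $i\in C_a^*$, so that $\|\mathbf f\|_1=\sum_{a,b}B_{ab}G_aG_b$. The variable $\mathbf Y$ ranges over symmetric $n\times n$ real matrices, $\langle\cdot,\cdot\rangle$ is the trace inner product, $\mathbf Y\succeq0$ means positive semidefinite, and $\|\mathbf Z\|_{1,\boldsymbol\theta}=\sum_{1\le i,j\le n}|\theta_iZ_{ij}\theta_j|$.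
   Formalization: The bound θ_iθ_jB_ab ≤ 1 is required also for i = j (θ_i²B_aa ≤ 1), since the claim fails without it (two singleton clusters, B_12 = 1, B_aa huge); for r = 1 the empty maximum over a < b is read as 0. *)

theory Defs
  imports "HOL-Probability.Probability" "HOL-Library.Disjoint_Sets"
begin

text \<open>
  Since the constant in the theorem must not depend on the dimension, \<open>n\<close> is a natural number
  rather than an index type: vectors and matrices are functions \<^typ>\<open>nat \<Rightarrow> real\<close> and
  \<^typ>\<open>nat \<Rightarrow> nat \<Rightarrow> real\<close> of which only the values at indices in \<open>{1..n}\<close>
  (or \<open>{1..r}\<close> for clusters) are used.
\<close>

definition symmetric_on :: "nat \<Rightarrow> (nat \<Rightarrow> nat \<Rightarrow> real) \<Rightarrow> bool" where
  "symmetric_on n Y \<longleftrightarrow> (\<forall>i\<in>{1..n}. \<forall>j\<in>{1..n}. Y i j = Y j i)"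

definition psd :: "nat \<Rightarrow> (nat \<Rightarrow> nat \<Rightarrow> real) \<Rightarrow> bool" where
  "psd n Y \<longleftrightarrow> symmetric_on n Y \<and>
     (\<forall>x :: nat \<Rightarrow> real. 0 \<le> (\<Sum>i=1..n. \<Sum>j=1..n. x i * Y i j * x j))"

definition trace_inner ::
    "nat \<Rightarrow> (nat \<Rightarrow> nat \<Rightarrow> real) \<Rightarrow> (nat \<Rightarrow> nat \<Rightarrow> real) \<Rightarrow> real" where
  "trace_inner n Y Z = (\<Sum>i=1..n. \<Sum>j=1..n. Y i j * Z i j)"

definition l1_norm :: "nat \<Rightarrow> (nat \<Rightarrow> real) \<Rightarrow> real" where
  "l1_norm n v = (\<Sum>i=1..n. \<bar>v i\<bar>)"

definition weighted_l1_norm :: "nat \<Rightarrow> (nat \<Rightarrow> real) \<Rightarrow> (nat \<Rightarrow> nat \<Rightarrow> real) \<Rightarrow> real" where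
  "weighted_l1_norm n \<theta> Z = (\<Sum>i=1..n. \<Sum>j=1..n. \<bar>\<theta> i * Z i j * \<theta> j\<bar>)"

definition degree :: "nat \<Rightarrow> (nat \<Rightarrow> nat \<Rightarrow> real) \<Rightarrow> nat \<Rightarrow> real" where
  "degree n A i = (\<Sum>j=1..n. A i j)"

definition cluster_of :: "nat \<Rightarrow> (nat \<Rightarrow> nat set) \<Rightarrow> nat \<Rightarrow> nat" where
  "cluster_of r C i = (THE a. a \<in> {1..r} \<and> i \<in> C a)"

text \<open>
  In \<open>dcsbm_params\<close> the bound \<open>\<theta> i * \<theta> j * B a b \<le> 1\<close> is imposed for all
  \<open>i \<in> C a\<close> and \<open>j \<in> C b\<close>, including \<open>i = j\<close>. No edge has the probability
  \<open>(\<theta> i)\<^sup>2 * B a a\<close>, but this quantity enters \<open>H\<close>, and without a bound on it (for instance if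
  every cluster is a singleton and the \<open>B a a\<close> are huge) the error bound fails.
\<close>

definition dcsbm_params ::
    "nat \<Rightarrow> nat \<Rightarrow> (nat \<Rightarrow> nat set) \<Rightarrow> (nat \<Rightarrow> real) \<Rightarrow> (nat \<Rightarrow> nat \<Rightarrow> real) \<Rightarrow> bool" where
  "dcsbm_params n r C \<theta> B \<longleftrightarrow>
     0 < n \<and>
     partition_on {1..n} (C ` {1..r}) \<and> inj_on C {1..r} \<and>
     (\<forall>i\<in>{1..n}. 0 \<le> \<theta> i) \<and> Max (\<theta> ` {1..n}) = 1 \<and>
     symmetric_on r B \<and> (\<forall>a\<in>{1..r}. \<forall>b\<in>{1..r}. 0 \<le> B a b) \<and>
     (\<forall>a\<in>{1..r}. \<forall>b\<in>{1..r}. \<forall>i\<in>C a. \<forall>j\<in>C b. \<theta> i * \<theta> j * B a b \<le> 1)"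

definition node_pairs :: "nat \<Rightarrow> (nat \<times> nat) set" where
  "node_pairs n = {(i, j). 1 \<le> i \<and> i < j \<and> j \<le> n}"

text \<open>
  The law of the adjacency matrix. The independent edge indicators \<open>E\<close> live on pairs
  \<open>(i, j)\<close> with \<open>i < j\<close> and are \<open>False\<close> elsewhere, so the disjunction below
  yields a symmetric matrix with zero diagonal.
\<close>

definition dcsbm ::
    "nat \<Rightarrow> nat \<Rightarrow> (nat \<Rightarrow> nat set) \<Rightarrow> (nat \<Rightarrow> real) \<Rightarrow> (nat \<Rightarrow> nat \<Rightarrow> real)
      \<Rightarrow> (nat \<Rightarrow> nat \<Rightarrow> real) pmf" where
  "dcsbm n r C \<theta> B =
     map_pmf (\<lambda>E i j. of_bool (E (i, j) \<or> E (j, i)))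
       (Pi_pmf (node_pairs n) False
         (\<lambda>(i, j). bernoulli_pmf (\<theta> i * \<theta> j * B (cluster_of r C i) (cluster_of r C j))))"

definition true_partition_matrix :: "nat \<Rightarrow> (nat \<Rightarrow> nat set) \<Rightarrow> nat \<Rightarrow> nat \<Rightarrow> real" where
  "true_partition_matrix r C i j = of_bool (\<exists>a\<in>{1..r}. i \<in> C a \<and> j \<in> C a)"

definition G :: "(nat \<Rightarrow> nat set) \<Rightarrow> (nat \<Rightarrow> real) \<Rightarrow> nat \<Rightarrow> real" where
  "G C \<theta> a = (\<Sum>i\<in>C a. \<theta> i)"

definition H ::
    "nat \<Rightarrow> (nat \<Rightarrow> nat set) \<Rightarrow> (nat \<Rightarrow> real) \<Rightarrow> (nat \<Rightarrow> nat \<Rightarrow> real) \<Rightarrow> nat \<Rightarrow> real" where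
  "H r C \<theta> B a = (\<Sum>b=1..r. B a b * G C \<theta> b)"

definition f_vec ::
    "nat \<Rightarrow> (nat \<Rightarrow> nat set) \<Rightarrow> (nat \<Rightarrow> real) \<Rightarrow> (nat \<Rightarrow> nat \<Rightarrow> real) \<Rightarrow> nat \<Rightarrow> real" where
  "f_vec r C \<theta> B i = \<theta> i * H r C \<theta> B (cluster_of r C i)"

text \<open>
  The maximum over \<open>1 \<le> a < b \<le> r\<close> of a nonnegative quantity. Inserting \<open>0\<close> changes
  nothing if \<open>r \<ge> 2\<close>; if \<open>r = 1\<close> it gives the empty maximum the value \<open>0\<close>.
\<close>

definition max_between :: "nat \<Rightarrow> (nat \<Rightarrow> nat \<Rightarrow> real) \<Rightarrow> real" where
  "max_between r g = Max (insert 0 {g a b | a b. 1 \<le> a \<and> a < b \<and> b \<le> r})"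

definition min_within :: "nat \<Rightarrow> (nat \<Rightarrow> real) \<Rightarrow> real" where
  "min_within r g = Min (g ` {1..r})"

definition feasible :: "nat \<Rightarrow> (nat \<Rightarrow> nat \<Rightarrow> real) \<Rightarrow> bool" where
  "feasible n Y \<longleftrightarrow> psd n Y \<and>
     (\<forall>i\<in>{1..n}. \<forall>j\<in>{1..n}. 0 \<le> Y i j \<and> Y i j \<le> 1) \<and> (\<forall>i\<in>{1..n}. Y i i = 1)"

definition solution ::
    "nat \<Rightarrow> real \<Rightarrow> (nat \<Rightarrow> nat \<Rightarrow> real) \<Rightarrow> (nat \<Rightarrow> nat \<Rightarrow> real) \<Rightarrow> bool" where
  "solution n lam A Y \<longleftrightarrow>
     is_arg_max (\<lambda>Y. trace_inner n Y (\<lambda>i j. A i j - lam * (degree n A i * degree n A j)))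
       (feasible n) Y"

end

(*
  Write P for the matrix of edge probabilities (including its diagonal) and W for the noise A - P
  off the diagonal. The bounds on lambda say that P - lambda f f^T is entrywise at least
  delta theta_i theta_j within clusters and at most -delta theta_i theta_j between clusters. Hence
  delta ||Y* - Y||_{1,theta} <= <Y* - Y, P - lambda f f^T>, and optimality of Y bounds this by
    <Y - Y*, W> - lambda <Y - Y*, d d^T - f f^T>.
  Let K be the supremum of |x^T W x| over the cube [-1,1]^n. Grothendieck's inequality for positive
  semidefinite matrices bounds the first term by 100 K; it is applied instead of an operator norm
  bound, which fails for sparse graphs. For the second term, ||d - f||_1 <= 2 K + n by
  polarization, so it is at most lambda (2 K + n) (||d||_1 + ||f||_1).
  As W has zero diagonal, K is attained at one of 2^n sign vectors, and Bernstein's inequality with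
  a union bound gives K = O(sqrt(n ||f||_1) + n) outside an event of probability 2 (e/2)^(-2n).
  Markov's inequality gives ||d||_1 <= 100 ||f||_1 with probability 0.99; concentration would not
  do here, since ||f||_1 may be much smaller than n.
*)

theory Submission imports Defs begin

section \<open>Positive semidefinite matrices and Grothendieck's inequality\<close>

definition quad_form :: "nat \<Rightarrow> (nat \<Rightarrow> nat \<Rightarrow> real) \<Rightarrow> (nat \<Rightarrow> real) \<Rightarrow> real" where
  "quad_form n M x = (\<Sum>i=1..n. \<Sum>j=1..n. x i * M i j * x j)"

definition cube :: "nat \<Rightarrow> (nat \<Rightarrow> real) set" where
  "cube n = {x. \<forall>i\<in>{1..n}. \<bar>x i\<bar> \<le> 1}"

text \<open>A list plays the role of a uniform random variable on its entries, counted with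
  multiplicity; this keeps the representation of matrices by random vectors free of measure
  theory.\<close>

definition avg :: "'a list \<Rightarrow> ('a \<Rightarrow> real) \<Rightarrow> real" where
  "avg xs f = (\<Sum>x\<leftarrow>xs. f x) / real (length xs)"

section \<open>Quadratic forms along one coordinate and Schur complements\<close>

lemma psd_iff_quad_form: "psd n Y \<longleftrightarrow> symmetric_on n Y \<and> (\<forall>x. 0 \<le> quad_form n Y x)"
  by (simp add: psd_def quad_form_def)

text \<open>This exact second-order expansion along a coordinate axis serves four times: for the
  sign of the pivots, the vanishing of rows, the completion of the square, and the passage from the
  cube to its vertices.\<close>

lemma quad_form_shift_coordinate:
  assumes "symmetric_on n M" "k \<in> {1..n}"
  shows "quad_form n M (x(k := x k + c))
    = quad_form n M x + 2 * c * (\<Sum>j=1..n. M k j * x j) + c\<^sup>2 * M k k"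
proof -
  let ?e = "\<lambda>i. c * of_bool (i = k)"
  have eq: "x(k := x k + c) = (\<lambda>i. x i + ?e i)" by auto
  have 1: "(\<Sum>i=1..n. \<Sum>j=1..n. ?e i * M i j * x j) = c * (\<Sum>j=1..n. M k j * x j)"
  proof -
    have "(\<Sum>i=1..n. \<Sum>j=1..n. ?e i * M i j * x j)
        = (\<Sum>i=1..n. if i = k then c * (\<Sum>j=1..n. M i j * x j) else 0)"
      by (intro sum.cong) (auto simp: sum_distrib_left mult.assoc)
    also have "\<dots> = c * (\<Sum>j=1..n. M k j * x j)"
      using assms(2) by (subst sum.delta) auto
    finally show ?thesis .
  qed
  have 2: "(\<Sum>i=1..n. \<Sum>j=1..n. x i * M i j * ?e j) = c * (\<Sum>j=1..n. M k j * x j)"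
  proof -
    have "(\<Sum>i=1..n. \<Sum>j=1..n. x i * M i j * ?e j) = (\<Sum>i=1..n. \<Sum>j=1..n. ?e i * M i j * x j)"
      using assms(1) by (subst sum.swap) (auto intro!: sum.cong simp: symmetric_on_def)
    then show ?thesis using 1 by simp
  qed
  have 3: "(\<Sum>i=1..n. \<Sum>j=1..n. ?e i * M i j * ?e j) = c\<^sup>2 * M k k"
  proof -
    have "(\<Sum>i=1..n. \<Sum>j=1..n. ?e i * M i j * ?e j)
        = (\<Sum>i=1..n. if i = k then (\<Sum>j=1..n. if j = k then c * c * M k j else 0) else 0)"
    proof (intro sum.cong refl)
      fix i assume "i \<in> {1..n}"
      have "(\<Sum>j=1..n. ?e i * M i j * ?e j)
          = (\<Sum>j=1..n. if i = k \<and> j = k then c * c * M k j else 0)"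
        by (intro sum.cong) auto
      then show "(\<Sum>j=1..n. ?e i * M i j * ?e j)
          = (if i = k then (\<Sum>j=1..n. if j = k then c * c * M k j else 0) else 0)"
        by simp
    qed
    also have "\<dots> = c\<^sup>2 * M k k"
      using assms(2) by (simp add: sum.delta power2_eq_square)
    finally show ?thesis .
  qed
  have "quad_form n M (\<lambda>i. x i + ?e i) = quad_form n M x
      + (\<Sum>i=1..n. \<Sum>j=1..n. ?e i * M i j * x j)
      + (\<Sum>i=1..n. \<Sum>j=1..n. x i * M i j * ?e j)
      + (\<Sum>i=1..n. \<Sum>j=1..n. ?e i * M i j * ?e j)"
    unfolding quad_form_def by (simp only: sum.distrib[symmetric] ring_distribs ac_simps)
  then show ?thesis unfolding eq 1 2 3 by simp
qed

lemma psd_diag_nonneg: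
  assumes "psd n Y" "k \<in> {1..n}"
  shows "0 \<le> Y k k"
proof -
  have "0 \<le> quad_form n Y ((\<lambda>_. 0)(k := (\<lambda>_. 0) k + 1))"
    using assms(1) by (simp only: psd_iff_quad_form)
  also have "\<dots> = Y k k"
    using assms by (subst quad_form_shift_coordinate) (auto simp: psd_def quad_form_def)
  finally show ?thesis .
qed

text \<open>If the pivot vanishes, the form at e_i + c e_k is affine in c, and an affine function
  bounded below on the whole line has slope zero.\<close>

lemma psd_zero_diag_row:
  assumes Y: "psd n Y" and k: "k \<in> {1..n}" and 0: "Y k k = 0" and i: "i \<in> {1..n}"
  shows "Y k i = 0"
proof (rule ccontr)
  assume ne: "Y k i \<noteq> 0"
  let ?x = "\<lambda>j. of_bool (j = i) :: real"
  define q where "q = quad_form n Y ?x"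
  have L: "(\<Sum>j=1..n. Y k j * ?x j) = Y k i"
    using i by (subst sum.cong[OF refl, of _ _ "\<lambda>j. if j = i then Y k j else 0"]) auto
  have "0 \<le> q + 2 * c * Y k i" for c
    using Y quad_form_shift_coordinate[of n Y k ?x c] k 0
    unfolding psd_iff_quad_form q_def L by (metis add.right_neutral mult_zero_right)
  \<comment> \<open>At this value of \<open>c\<close> the affine function would be negative.\<close>
  moreover have "q + 2 * (- (q + 1) / (2 * Y k i)) * Y k i = - 1"
    using ne by (simp add: field_simps)
  ultimately show False by (metis not_one_le_zero neg_0_le_iff_le)
qed

text \<open>Removing the rank-one part of the pivot amounts to minimizing over the k-th coordinate:
  after completing the square, the new form at \<open>x\<close> is the old form at a shifted
  point.\<close>

lemma psd_schur_complement:
  assumes Y: "psd n Y" and k: "k \<in> {1..n}" and pos: "Y k k > 0"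
  shows "psd n (\<lambda>i j. Y i j - Y k i * Y k j / Y k k)"
proof -
  have sym: "symmetric_on n Y" using Y by (simp add: psd_def)
  have "0 \<le> quad_form n (\<lambda>i j. Y i j - Y k i * Y k j / Y k k) x" for x
  proof -
    define L where "L = (\<Sum>j=1..n. Y k j * x j)"
    have "quad_form n (\<lambda>i j. Y i j - Y k i * Y k j / Y k k) x
        = quad_form n Y x - (\<Sum>i=1..n. \<Sum>j=1..n. (Y k i * x i) * (Y k j * x j)) / Y k k"
      unfolding quad_form_def sum_divide_distrib sum_subtractf[symmetric]
      by (intro sum.cong refl) (simp add: field_simps)
    also have "(\<Sum>i=1..n. \<Sum>j=1..n. (Y k i * x i) * (Y k j * x j)) = L * L"
      unfolding L_def sum_product ..
    also have "quad_form n Y x - L * L / Y k k = quad_form n Y (x(k := x k + (- L / Y k k)))"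
      using pos unfolding quad_form_shift_coordinate[OF sym k] L_def[symmetric]
      by (simp add: field_simps power2_eq_square)
    also have "\<dots> \<ge> 0" using Y by (simp add: psd_iff_quad_form)
    finally show ?thesis .
  qed
  moreover have "symmetric_on n (\<lambda>i j. Y i j - Y k i * Y k j / Y k k)"
    using sym by (simp add: symmetric_on_def)
  ultimately show ?thesis by (simp add: psd_iff_quad_form)
qed

section \<open>Averages over lists and sums with random signs\<close>

lemma avg_add: "avg xs (\<lambda>x. f x + g x) = avg xs f + avg xs g"
  by (simp add: avg_def sum_list_addf add_divide_distrib)

lemma avg_diff: "avg xs (\<lambda>x. f x - g x) = avg xs f - avg xs g"
  by (simp add: avg_def sum_list_subtractf diff_divide_distrib)

lemma avg_cmult: "avg xs (\<lambda>x. c * f x) = c * avg xs f"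
  by (simp add: avg_def sum_list_const_mult)

lemma avg_const: "xs \<noteq> [] \<Longrightarrow> avg xs (\<lambda>_. c) = c"
  by (simp add: avg_def sum_list_triv)

lemma avg_mono: "(\<And>x. x \<in> set xs \<Longrightarrow> f x \<le> g x) \<Longrightarrow> avg xs f \<le> avg xs g"
  by (auto simp: avg_def intro!: divide_right_mono sum_list_mono)

lemma avg_sum: "avg xs (\<lambda>x. \<Sum>i\<in>I. f i x) = (\<Sum>i\<in>I. avg xs (f i))"
proof -
  have "(\<Sum>x\<leftarrow>xs. \<Sum>i\<in>I. f i x) = (\<Sum>i\<in>I. \<Sum>x\<leftarrow>xs. f i x)"
    by (induction xs) (simp_all add: sum.distrib)
  then show ?thesis by (simp add: avg_def sum_divide_distrib)
qed

text \<open>Doubling the list in this way adds \<open>u\<close> multiplied by an independent fair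
  sign.\<close>

lemma avg_sign_split:
  "avg (map (\<lambda>x i. x i + u i) xs @ map (\<lambda>x i. x i - u i) xs) f
    = avg xs (\<lambda>x. (f (\<lambda>i. x i + u i) + f (\<lambda>i. x i - u i)) / 2)"
proof -
  have "(\<Sum>x\<leftarrow>xs. (f (\<lambda>i. x i + u i) + f (\<lambda>i. x i - u i)) / 2)
      = ((\<Sum>x\<leftarrow>xs. f (\<lambda>i. x i + u i)) + (\<Sum>x\<leftarrow>xs. f (\<lambda>i. x i - u i))) / 2"
    by (induction xs) (simp_all add: field_simps)
  then show ?thesis unfolding avg_def by (simp only:) (simp add: o_def)
qed

text \<open>The quadratic form of a second-moment matrix is an average of squares.\<close>

lemma psd_avg_outer: "psd n (\<lambda>i j. avg xs (\<lambda>x. g x i * g x j))"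
proof -
  have "quad_form n (\<lambda>i j. avg xs (\<lambda>x. g x i * g x j)) z
      = avg xs (\<lambda>x. (\<Sum>i=1..n. z i * g x i)\<^sup>2)" for z
  proof -
    have "avg xs (\<lambda>x. (\<Sum>i=1..n. z i * g x i)\<^sup>2)
        = (\<Sum>i=1..n. \<Sum>j=1..n. avg xs (\<lambda>x. (z i * z j) * (g x i * g x j)))"
      unfolding power2_eq_square sum_product avg_sum by (simp only: ac_simps)
    then show ?thesis
      unfolding quad_form_def avg_cmult by (simp add: ac_simps)
  qed
  moreover have "0 \<le> avg xs (\<lambda>x. (\<Sum>i=1..n. z i * g x i)\<^sup>2)" for z
    by (auto simp: avg_def intro!: divide_nonneg_nonneg sum_list_nonneg)
  ultimately show ?thesis
    by (simp add: psd_iff_quad_form symmetric_on_def mult.commute)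
qed

text \<open>The list enumerates the values of \<open>\<Sum>k. \<epsilon>\<^sub>k u\<^sub>k\<close> over all signs, where \<open>Y = \<Sum>k. u\<^sub>k u\<^sub>k\<^sup>T\<close> is
  obtained by eliminating one coordinate at a time.\<close>

lemma psd_rademacher_representation:
  assumes "psd n Y"
  shows "\<exists>xs. xs \<noteq> [] \<and>
    (\<forall>i\<in>{1..n}. \<forall>j\<in>{1..n}. avg xs (\<lambda>x. x i * x j) = Y i j) \<and>
    (\<forall>i\<in>{1..n}. avg xs (\<lambda>x. x i ^ 4) \<le> 3 * (Y i i)\<^sup>2)"
proof -
  \<comment> \<open>Induction on the number \<open>m\<close> of leading coordinates not yet
    eliminated; the rows beyond \<open>m\<close> are already zero.\<close>
  have "\<exists>xs. xs \<noteq> [] \<and>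
      (\<forall>i\<in>{1..n}. \<forall>j\<in>{1..n}. avg xs (\<lambda>x. x i * x j) = Y i j) \<and>
      (\<forall>i\<in>{1..n}. avg xs (\<lambda>x. x i ^ 4) \<le> 3 * (Y i i)\<^sup>2)"
    if "psd n Y" "m \<le> n" "\<And>i j. i \<in> {m<..n} \<Longrightarrow> j \<in> {1..n} \<Longrightarrow> Y i j = 0" for m Y
    using that
  proof (induction m arbitrary: Y)
    case 0
    then have "\<forall>i\<in>{1..n}. \<forall>j\<in>{1..n}. Y i j = 0" by auto
    then show ?case
      by (intro exI[of _ "[\<lambda>_. 0]"]) (simp add: avg_def)
  next
    case (Suc m)
    let ?k = "Suc m"
    have k: "?k \<in> {1..n}" using Suc.prems by simp
    show ?case
    proof (cases "Y ?k ?k = 0")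
      case True
      have "Y i j = 0" if "i \<in> {m<..n}" "j \<in> {1..n}" for i j
        using that Suc.prems(3)[of i j] psd_zero_diag_row[OF Suc.prems(1) k True, of j]
        by (cases "i = ?k") auto
      then show ?thesis using Suc.IH[of Y] Suc.prems by simp
    next
      case False
      with psd_diag_nonneg[OF Suc.prems(1) k] have pos: "Y ?k ?k > 0" by simp
      \<comment> \<open>The rank-one matrix of \<open>u\<close> carries the whole pivot row, so
        \<open>Z\<close> lives on the first \<open>m\<close> coordinates.\<close>
      define Z where "Z = (\<lambda>i j. Y i j - Y ?k i * Y ?k j / Y ?k ?k)"
      define u where "u = (\<lambda>i. Y ?k i / sqrt (Y ?k ?k))"
      have sym: "Y i j = Y j i" if "i \<in> {1..n}" "j \<in> {1..n}" for i j
        using Suc.prems(1) that by (simp add: psd_def symmetric_on_def)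
      have Z: "psd n Z"
        unfolding Z_def by (rule psd_schur_complement[OF Suc.prems(1) k pos])
      have u: "Y i j = Z i j + u i * u j" for i j
        using pos by (simp add: Z_def u_def)
      have "Z i j = 0" if "i \<in> {m<..n}" "j \<in> {1..n}" for i j
      proof (cases "i = ?k")
        case True
        then show ?thesis using pos by (simp add: Z_def)
      next
        case False
        then have "Y i j = 0" "Y i ?k = 0" using that k Suc.prems(3) by auto
        then show ?thesis using sym[of i ?k] that k by (simp add: Z_def)
      qed
      with Suc.IH[of Z] Z Suc.prems(2) obtain xs where xs: "xs \<noteq> []"
        "\<And>i j. i \<in> {1..n} \<Longrightarrow> j \<in> {1..n} \<Longrightarrow> avg xs (\<lambda>x. x i * x j) = Z i j"
        "\<And>i. i \<in> {1..n} \<Longrightarrow> avg xs (\<lambda>x. x i ^ 4) \<le> 3 * (Z i i)\<^sup>2"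
        by auto
      let ?xs = "map (\<lambda>x i. x i + u i) xs @ map (\<lambda>x i. x i - u i) xs"
      have "avg ?xs (\<lambda>x. x i * x j) = Y i j" if "i \<in> {1..n}" "j \<in> {1..n}" for i j
      proof -
        have "avg ?xs (\<lambda>x. x i * x j) = avg xs (\<lambda>x. x i * x j + u i * u j)"
          unfolding avg_sign_split by (intro arg_cong[of _ _ "avg xs"] ext) (simp add: field_simps)
        then show ?thesis using xs that by (simp add: avg_add avg_const u)
      qed
      moreover have "avg ?xs (\<lambda>x. x i ^ 4) \<le> 3 * (Y i i)\<^sup>2" if "i \<in> {1..n}" for i
      proof -
        \<comment> \<open>Averaging over the sign cancels the odd powers.\<close>
        have id: "((a + b) ^ 4 + (a - b) ^ 4) / 2 = a ^ 4 + (6 * b\<^sup>2) * (a * a) + b ^ 4"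
          for a b :: real by (simp add: field_simps power2_eq_square power4_eq_xxxx)
        have u4: "0 \<le> u i ^ 4" by simp
        have "avg ?xs (\<lambda>x. x i ^ 4) = avg xs (\<lambda>x. x i ^ 4) + 6 * (u i)\<^sup>2 * Z i i + u i ^ 4"
          unfolding avg_sign_split id avg_add avg_cmult
          using xs that by (simp add: avg_const)
        \<comment> \<open>Relaxing \<open>u i ^ 4\<close> to three times itself completes the square
          3 (Z i i + (u i)^2)^2, so the constant 3 survives the induction.\<close>
        also have "avg xs (\<lambda>x. x i ^ 4) + 6 * (u i)\<^sup>2 * Z i i + u i ^ 4
            \<le> 3 * (Z i i)\<^sup>2 + 6 * (u i)\<^sup>2 * Z i i + 3 * u i ^ 4"
          using xs(3)[OF that] u4 by linarith
        also have "\<dots> = 3 * (Y i i)\<^sup>2"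
          by (simp add: u[of i i] field_simps power2_eq_square power4_eq_xxxx)
        finally show ?thesis .
      qed
      ultimately show ?thesis
        using xs(1) by (intro exI[of _ ?xs]) simp
    qed
  qed
  from this[of Y n] assms show ?thesis by simp
qed

section \<open>Grothendieck's inequality by truncation\<close>

lemma avg_abs_le:
  assumes "xs \<noteq> []" "\<And>x. \<bar>f x\<bar> \<le> c"
  shows "\<bar>avg xs f\<bar> \<le> c"
proof -
  have "f x \<le> c" "- c \<le> f x" for x using assms(2)[of x] by auto
  then show ?thesis
    using avg_mono[of xs f "\<lambda>_. c"] avg_mono[of xs "\<lambda>_. - c" f] assms(1)
    by (simp add: avg_const)
qed

text \<open>A pairing with a matrix becomes an average of quadratic forms, to which a bound on the
  cube applies entry by entry of the list.\<close>

lemma trace_inner_avg_outer: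
  "trace_inner n M (\<lambda>i j. avg xs (\<lambda>x. g x i * g x j)) = avg xs (\<lambda>x. quad_form n M (g x))"
  unfolding trace_inner_def quad_form_def avg_sum avg_cmult[symmetric]
  by (simp only: ac_simps)

lemma trace_inner_cmult: "trace_inner n M (\<lambda>i j. c * Z i j) = c * trace_inner n M Z"
  by (simp add: trace_inner_def sum_distrib_left ac_simps)

lemma psd_cmult:
  assumes "psd n Z" "0 \<le> c"
  shows "psd n (\<lambda>i j. c * Z i j)"
proof -
  have "quad_form n (\<lambda>i j. c * Z i j) x = c * quad_form n Z x" for x
    by (simp add: quad_form_def sum_distrib_left ac_simps)
  with assms show ?thesis by (simp add: psd_iff_quad_form symmetric_on_def)
qed

text \<open>In the representation this is the average of 2 |a b| <= a^2 + b^2. It makes the supremum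
  in Grothendieck's inequality finite, so that it can be absorbed.\<close>

lemma psd_entry_le_1:
  assumes Y: "psd n Y" "\<And>i. i \<in> {1..n} \<Longrightarrow> Y i i \<le> 1" and ij: "i \<in> {1..n}" "j \<in> {1..n}"
  shows "\<bar>Y i j\<bar> \<le> 1"
proof -
  obtain xs where xs: "xs \<noteq> []"
    "\<And>i j. i \<in> {1..n} \<Longrightarrow> j \<in> {1..n} \<Longrightarrow> avg xs (\<lambda>x. x i * x j) = Y i j"
    using psd_rademacher_representation[OF Y(1)] by blast
  have "2 * Y i j = avg xs (\<lambda>x. 2 * (x i * x j))" "- 2 * Y i j = avg xs (\<lambda>x. - 2 * (x i * x j))"
    using xs(2)[OF ij] by (simp_all only: avg_cmult)
  moreover have "avg xs (\<lambda>x. 2 * (x i * x j)) \<le> avg xs (\<lambda>x. x i * x i + x j * x j)"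
  proof (intro avg_mono)
    fix x :: "nat \<Rightarrow> real"
    have "0 \<le> (x i - x j) * (x i - x j)" by simp
    then show "2 * (x i * x j) \<le> x i * x i + x j * x j" by (simp add: algebra_simps)
  qed
  moreover have "avg xs (\<lambda>x. - 2 * (x i * x j)) \<le> avg xs (\<lambda>x. x i * x i + x j * x j)"
  proof (intro avg_mono)
    fix x :: "nat \<Rightarrow> real"
    have "0 \<le> (x i + x j) * (x i + x j)" by simp
    then show "- 2 * (x i * x j) \<le> x i * x i + x j * x j" by (simp add: algebra_simps)
  qed
  moreover have "avg xs (\<lambda>x. x i * x i + x j * x j) \<le> 2"
    using xs(2) Y(2)[OF ij(1)] Y(2)[OF ij(2)] ij by (simp add: avg_add)
  ultimately show ?thesis by simp
qed

text \<open>The level 5 costs a factor 25 on the cube and leaves a remainder of second moment at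
  most 3/400, small enough for the absorption.\<close>

definition trunc5 :: "real \<Rightarrow> real" where
  "trunc5 x = max (- 5) (min 5 x)"

lemma abs_trunc5_le: "\<bar>trunc5 x\<bar> \<le> 5"
  by (auto simp: trunc5_def)

lemma trunc5_square_le: "(trunc5 x)\<^sup>2 \<le> x * x"
  unfolding power2_eq_square[symmetric] abs_le_square_iff[symmetric] by (auto simp: trunc5_def)

text \<open>Beyond the level, the remainder has size |x| - 5, a line tangent to x^2 / 20 at 10.
  Squaring gives a fourth power, whose average the representation controls.\<close>

lemma trunc5_remainder: "(x - trunc5 x)\<^sup>2 \<le> x ^ 4 / 400"
proof -
  have 0: "0 \<le> (\<bar>x\<bar> - 10)\<^sup>2" by simp
  have "\<bar>x - trunc5 x\<bar> \<le> x\<^sup>2 / 20"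
  proof (cases "\<bar>x\<bar> \<le> 5")
    case False
    then have "\<bar>x - trunc5 x\<bar> = \<bar>x\<bar> - 5" by (auto simp: trunc5_def)
    also have "\<dots> \<le> x\<^sup>2 / 20" using 0 by (simp add: power2_diff)
    finally show ?thesis .
  qed (auto simp: trunc5_def)
  then have "\<bar>x - trunc5 x\<bar>\<^sup>2 \<le> (x\<^sup>2 / 20)\<^sup>2" by (intro power_mono) auto
  then show ?thesis by (simp add: power_divide flip: power_mult)
qed

text \<open>With \<open>x = t + r\<close> for the truncation \<open>t\<close> of the representing vector \<open>x\<close>, the part of
  \<open>\<langle>M, Y\<rangle>\<close> coming from \<open>t\<close> is controlled by the cube, and the
  remainder is at most half of the supremum over all \<open>Y\<close>; so the supremum can be
  absorbed.\<close>

lemma grothendieck_psd: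
  assumes K: "\<And>x. x \<in> cube n \<Longrightarrow> \<bar>quad_form n M x\<bar> \<le> K"
    and Y: "psd n Y" "\<And>i. i \<in> {1..n} \<Longrightarrow> Y i i \<le> 1"
  shows "\<bar>trace_inner n M Y\<bar> \<le> 50 * K"
proof -
  define \<Gamma> where "\<Gamma> = {Y. psd n Y \<and> (\<forall>i\<in>{1..n}. Y i i \<le> 1)}"
  define S where "S = (SUP Y\<in>\<Gamma>. \<bar>trace_inner n M Y\<bar>)"
  have Y_in: "Y \<in> \<Gamma>" using Y by (simp add: \<Gamma>_def)
  have "bdd_above ((\<lambda>Y. \<bar>trace_inner n M Y\<bar>) ` \<Gamma>)"
  proof (rule bdd_aboveI2)
    fix Z assume "Z \<in> \<Gamma>"
    then have "\<bar>Z i j\<bar> \<le> 1" if "i \<in> {1..n}" "j \<in> {1..n}" for i j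
      using psd_entry_le_1[of n Z] that by (auto simp: \<Gamma>_def)
    then show "\<bar>trace_inner n M Z\<bar> \<le> (\<Sum>i=1..n. \<Sum>j=1..n. \<bar>M i j\<bar>)"
      unfolding trace_inner_def
      by (intro order.trans[OF sum_abs] sum_mono) (auto simp: abs_mult intro!: mult_left_le)
  qed
  then have S: "\<bar>trace_inner n M Z\<bar> \<le> S" if "Z \<in> \<Gamma>" for Z
    unfolding S_def by (rule cSUP_upper[OF that])
  \<comment> \<open>By homogeneity, a bound on the diagonal alone bounds the pairing.\<close>
  have S_scaled: "\<bar>trace_inner n M Z\<bar> \<le> c * S"
    if "psd n Z" "\<And>i. i \<in> {1..n} \<Longrightarrow> Z i i \<le> c" "c > 0" for Z c
  proof -
    have "(\<lambda>i j. (1 / c) * Z i j) \<in> \<Gamma>"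
      using that psd_cmult[of n Z "1 / c"] by (auto simp: \<Gamma>_def)
    from S[OF this] show ?thesis
      unfolding trace_inner_cmult using that(3) by (simp add: abs_mult field_simps)
  qed
  have "\<bar>trace_inner n M Z\<bar> \<le> 25 * K + S / 2" if "Z \<in> \<Gamma>" for Z
  proof -
    have "psd n Z" using that by (simp add: \<Gamma>_def)
    from psd_rademacher_representation[OF this] obtain xs where xs: "xs \<noteq> []"
      "\<And>i j. i \<in> {1..n} \<Longrightarrow> j \<in> {1..n} \<Longrightarrow> avg xs (\<lambda>x. x i * x j) = Z i j"
      "\<And>i. i \<in> {1..n} \<Longrightarrow> avg xs (\<lambda>x. x i ^ 4) \<le> 3 * (Z i i)\<^sup>2"
      by blast
    define t r where "t = (\<lambda>(x :: nat \<Rightarrow> real) i. trunc5 (x i))"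
      and "r = (\<lambda>(x :: nat \<Rightarrow> real) i. x i - trunc5 (x i))"
    let ?q = "\<lambda>g. avg xs (\<lambda>x. quad_form n M (g x))"
    have Zii: "0 \<le> Z i i" "Z i i \<le> 1" if "i \<in> {1..n}" for i
      using that \<open>Z \<in> \<Gamma>\<close> psd_diag_nonneg[of n Z i] by (auto simp: \<Gamma>_def)
    have Et: "avg xs (\<lambda>x. (t x i)\<^sup>2) \<le> 1" if "i \<in> {1..n}" for i
    proof -
      have "avg xs (\<lambda>x. (t x i)\<^sup>2) \<le> avg xs (\<lambda>x. x i * x i)"
        by (intro avg_mono) (simp add: t_def trunc5_square_le)
      then show ?thesis using xs(2) Zii that by fastforce
    qed
    \<comment> \<open>The factor 1/400 of the remainder bound meets the fourth-moment constant
      3.\<close>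
    have Er: "avg xs (\<lambda>x. (r x i)\<^sup>2) \<le> 3 / 400" if "i \<in> {1..n}" for i
    proof -
      have "avg xs (\<lambda>x. (r x i)\<^sup>2) \<le> avg xs (\<lambda>x. (1 / 400) * x i ^ 4)"
        using trunc5_remainder by (intro avg_mono) (simp add: r_def)
      also have "\<dots> \<le> (1 / 400) * (3 * (Z i i)\<^sup>2)"
        unfolding avg_cmult using xs(3)[OF that] by simp
      also have "(Z i i)\<^sup>2 \<le> 1" using Zii[OF that] by (simp add: power_le_one)
      finally show ?thesis by simp
    qed
    have psd: "\<bar>?q g\<bar> \<le> c * S"
      if "\<And>i. i \<in> {1..n} \<Longrightarrow> avg xs (\<lambda>x. (g x i)\<^sup>2) \<le> c" "c > 0" for g c
      using S_scaled[OF psd_avg_outer[of n xs g]] that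
      by (simp add: trace_inner_avg_outer power2_eq_square)
    \<comment> \<open>The weight 10 balances the small \<open>r\<close> against \<open>t\<close>,
      with 200 * 3/400 + 2 = 7/2. With weight 1 the same estimate would leave about 2
      \<open>S\<close> in the end, too much to absorb.\<close>
    have mixed: "avg xs (\<lambda>x. (10 * r x i + s * t x i)\<^sup>2) \<le> 7 / 2"
      if "i \<in> {1..n}" "s * s = 1" for i s
    proof -
      have "avg xs (\<lambda>x. (10 * r x i + s * t x i)\<^sup>2)
          \<le> avg xs (\<lambda>x. 200 * (r x i)\<^sup>2 + 2 * (t x i)\<^sup>2)"
      proof (intro avg_mono)
        fix x
        have "0 \<le> (10 * r x i - s * t x i)\<^sup>2" by simp
        moreover have "s\<^sup>2 = 1" using that(2) by (simp add: power2_eq_square)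
        ultimately show "(10 * r x i + s * t x i)\<^sup>2 \<le> 200 * (r x i)\<^sup>2 + 2 * (t x i)\<^sup>2"
          by (simp add: power2_sum power2_diff power_mult_distrib)
      qed
      also have "\<dots> \<le> 7 / 2"
        unfolding avg_add avg_cmult using Et[OF that(1)] Er[OF that(1)] by simp
      finally show ?thesis .
    qed
    \<comment> \<open>Weighted polarization: the difference of the two mixed forms is 20 times the
      sum of the cross terms between \<open>t x\<close> and \<open>r x\<close>.\<close>
    have split: "quad_form n M x = quad_form n M (t x)
        + (quad_form n M (\<lambda>i. 10 * r x i + 1 * t x i)
            - quad_form n M (\<lambda>i. 10 * r x i + (- 1) * t x i)) / 20
        + quad_form n M (r x)" for x
    proof -
      have x: "x i = t x i + r x i" for i by (simp add: t_def r_def)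
      have id: "(a + b) * m * (c + d) = a * m * c + ((10 * b + 1 * a) * m * (10 * d + 1 * c)
          - (10 * b + (- 1) * a) * m * (10 * d + (- 1) * c)) / 20 + b * m * d"
        for a b c d m :: real by (simp add: field_simps)
      show ?thesis
        unfolding quad_form_def sum_subtractf[symmetric] sum_divide_distrib sum.distrib[symmetric]
      proof (intro sum.cong refl)
        fix i j
        show "x i * M i j * x j = t x i * M i j * t x j
            + ((10 * r x i + 1 * t x i) * M i j * (10 * r x j + 1 * t x j)
              - (10 * r x i + (- 1) * t x i) * M i j * (10 * r x j + (- 1) * t x j)) / 20
            + r x i * M i j * r x j"
          by (subst x[of i], subst x[of j], rule id)
      qed
    qed
    have "trace_inner n M Z = avg xs (quad_form n M)"
      using xs(2) trace_inner_avg_outer[of n M xs "\<lambda>x. x"] by (simp add: trace_inner_def)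
    also have "\<dots> = avg xs (\<lambda>x. quad_form n M (t x)
        + (1 / 20) * (quad_form n M (\<lambda>i. 10 * r x i + 1 * t x i)
            - quad_form n M (\<lambda>i. 10 * r x i + (- 1) * t x i))
        + quad_form n M (r x))"
      by (intro arg_cong[of _ _ "avg xs"] ext, subst split) simp
    also have "\<dots> = ?q t + (1 / 20) * (?q (\<lambda>x i. 10 * r x i + 1 * t x i)
            - ?q (\<lambda>x i. 10 * r x i + (- 1) * t x i)) + ?q r"
      unfolding avg_add avg_cmult avg_diff ..
    also have "\<bar>\<dots>\<bar> \<le> 25 * K + (1 / 20) * (7 / 2 * S + 7 / 2 * S) + 3 / 400 * S"
    proof -
      have "\<bar>?q t\<bar> \<le> 25 * K"
      proof (rule avg_abs_le[OF xs(1)])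
        fix x
        have "(\<lambda>i. t x i / 5) \<in> cube n"
          using abs_trunc5_le by (simp add: cube_def t_def)
        from K[OF this] have "\<bar>quad_form n M (\<lambda>i. t x i / 5)\<bar> \<le> K" .
        moreover have "quad_form n M (t x) = 25 * quad_form n M (\<lambda>i. t x i / 5)"
          by (simp add: quad_form_def sum_distrib_left)
        ultimately show "\<bar>quad_form n M (t x)\<bar> \<le> 25 * K" by simp
      qed
      moreover have "\<bar>?q (\<lambda>x i. 10 * r x i + 1 * t x i)\<bar> \<le> 7 / 2 * S"
        "\<bar>?q (\<lambda>x i. 10 * r x i + (- 1) * t x i)\<bar> \<le> 7 / 2 * S"
        by ((rule psd, rule mixed; simp), (rule psd, rule mixed; simp))
      moreover have "\<bar>?q r\<bar> \<le> 3 / 400 * S" by (rule psd[OF Er]) auto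
      moreover have "\<bar>a + (1 / 20) * (b - c) + d\<bar> \<le> 25 * K + (1 / 20) * (7 / 2 * S + 7 / 2 * S) + 3 / 400 * S"
        if "\<bar>a\<bar> \<le> 25 * K" "\<bar>b\<bar> \<le> 7 / 2 * S" "\<bar>c\<bar> \<le> 7 / 2 * S" "\<bar>d\<bar> \<le> 3 / 400 * S"
        for a b c d using that unfolding abs_le_iff by argo
      ultimately show ?thesis by blast
    qed
    \<comment> \<open>The coefficient of \<open>S\<close> is 7/20 + 3/400 = 143/400, and
      \<open>S\<close> is nonnegative because it bounds an absolute value.\<close>
    also have "\<dots> \<le> 25 * K + S / 2"
      using S[OF that] by simp
    finally show ?thesis .
  qed
  then have "S \<le> 25 * K + S / 2"
    using Y_in unfolding S_def by (intro cSUP_least) auto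
  with S[OF Y_in] show ?thesis by simp
qed

section \<open>Quadratic forms on the cube\<close>

lemma quad_form_le_sign_vector:
  assumes sym: "symmetric_on n W" and diag: "\<And>i. i \<in> {1..n} \<Longrightarrow> W i i = 0" and x: "x \<in> cube n"
  shows "\<exists>s. (\<forall>i\<in>{1..n}. s i \<in> {-1, 1}) \<and> quad_form n W x \<le> quad_form n W s"
proof -
  \<comment> \<open>Coordinates are replaced by signs one at a time. With zero diagonal the form is
    affine in each of them, so moving to the endpoint of [-1, 1] on the side of the slope does not
    decrease it.\<close>
  have "\<exists>s\<in>cube n. (\<forall>i\<in>{1..m}. s i \<in> {-1, 1}) \<and> quad_form n W x \<le> quad_form n W s" if "m \<le> n" for m
    using that
  proof (induction m)
    case 0
    then show ?case using x by auto
  next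
    case (Suc m)
    then obtain s where s: "s \<in> cube n" "\<forall>i\<in>{1..m}. s i \<in> {-1, 1}"
      "quad_form n W x \<le> quad_form n W s" by auto
    define L where "L = (\<Sum>j=1..n. W (Suc m) j * s j)"
    have k: "Suc m \<in> {1..n}" using Suc.prems by simp
    define e :: real where "e = (if L \<ge> 0 then 1 else - 1)"
    have sk: "\<bar>s (Suc m)\<bar> \<le> 1" using s(1) k by (auto simp: cube_def)
    have "quad_form n W (s(Suc m := e)) = quad_form n W s + 2 * (e - s (Suc m)) * L"
      using diag[OF k] quad_form_shift_coordinate[OF sym k, of s "e - s (Suc m)"]
      by (simp add: L_def)
    moreover have "2 * (e - s (Suc m)) * L \<ge> 0"
    proof (cases "L \<ge> 0")
      case True
      then show ?thesis using sk by (auto simp: e_def)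
    next
      case False
      then show ?thesis using sk by (auto simp: e_def intro!: mult_nonpos_nonpos)
    qed
    ultimately have "quad_form n W x \<le> quad_form n W (s(Suc m := e))" using s(3) by linarith
    moreover have "s(Suc m := e) \<in> cube n" using s(1) by (auto simp: cube_def e_def)
    moreover have "\<forall>i\<in>{1..Suc m}. (s(Suc m := e)) i \<in> {-1, 1}"
      using s(2) by (auto simp: e_def)
    ultimately show ?case by blast
  qed
  then show ?thesis by blast
qed

text \<open>With \<open>s\<close> the signs of the row sums, the left side is the bilinear form at
  \<open>s\<close> and the all-ones vector. Polarization makes it a difference of two values of the
  quadratic form, both at points of the cube.\<close>

lemma sum_abs_rows_le:
  assumes sym: "symmetric_on n W" and K: "\<And>x. x \<in> cube n \<Longrightarrow> \<bar>quad_form n W x\<bar> \<le> K"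
  shows "(\<Sum>i=1..n. \<bar>\<Sum>j=1..n. W i j\<bar>) \<le> 2 * K"
proof -
  define s :: "nat \<Rightarrow> real" where "s = (\<lambda>i. if (\<Sum>j=1..n. W i j) \<ge> 0 then 1 else - 1)"
  have "(\<Sum>i=1..n. \<bar>\<Sum>j=1..n. W i j\<bar>) = (\<Sum>i=1..n. \<Sum>j=1..n. s i * W i j)"
    by (intro sum.cong refl) (auto simp: s_def sum_negf abs_if)
  also have "\<dots> = ((\<Sum>i=1..n. \<Sum>j=1..n. s i * W i j) + (\<Sum>i=1..n. \<Sum>j=1..n. s j * W i j)) / 2"
  proof -
    have "(\<Sum>i=1..n. \<Sum>j=1..n. s j * W i j) = (\<Sum>i=1..n. \<Sum>j=1..n. s i * W i j)"
      using sym by (subst sum.swap) (auto simp: symmetric_on_def intro!: sum.cong)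
    then show ?thesis by simp
  qed
  also have "\<dots> = quad_form n W (\<lambda>i. (s i + 1) / 2) - quad_form n W (\<lambda>i. (s i - 1) / 2)"
    unfolding quad_form_def sum_subtractf[symmetric] sum.distrib[symmetric] sum_divide_distrib
    by (intro sum.cong refl) (simp add: field_simps)
  also have "\<dots> \<le> 2 * K"
  proof -
    have "(\<lambda>i. (s i + 1) / 2) \<in> cube n" "(\<lambda>i. (s i - 1) / 2) \<in> cube n"
      by (auto simp: cube_def s_def)
    from this[THEN K] show ?thesis by linarith
  qed
  finally show ?thesis .
qed

section \<open>Deviations of sums of independent Bernoulli variables\<close>

text \<open>For negative y, exp y <= 1 / (1 - y), and (1 + y + y^2) (1 - y) = 1 - y^3 >= 1.\<close>

lemma exp_le_one_plus_plus_square: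
  fixes y :: real
  assumes "\<bar>y\<bar> \<le> 1"
  shows "exp y \<le> 1 + y + y\<^sup>2"
proof (cases "y \<ge> 0")
  case True
  then show ?thesis using exp_bound[of y] assms by simp
next
  case False
  have "1 - y \<le> exp (- y)" using exp_ge_add_one_self[of "- y"] by simp
  then have "exp y \<le> 1 / (1 - y)" using False by (simp add: exp_minus field_simps)
  also have "\<dots> \<le> 1 + y + y\<^sup>2"
  proof -
    have "0 \<le> y\<^sup>2 * (- y)" using False by (intro mult_nonneg_nonneg) auto
    then have "1 \<le> (1 + y + y\<^sup>2) * (1 - y)" by (simp add: algebra_simps power2_eq_square)
    then show ?thesis using False by (simp add: divide_le_eq)
  qed
  finally show ?thesis .
qed

text \<open>Centring cancels the linear terms, and the quadratic ones leave the variance p (1 - p).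
  Keeping \<open>p\<close> in the exponent makes the deviation bound sensitive to sparsity.\<close>

lemma bernoulli_exp_moment_le:
  fixes p c :: real
  assumes p: "0 \<le> p" "p \<le> 1" and c: "\<bar>c\<bar> \<le> 1"
  shows "measure_pmf.expectation (bernoulli_pmf p) (\<lambda>b. exp (c * (of_bool b - p))) \<le> exp (c\<^sup>2 * p)"
proof -
  have le: "\<bar>c * (1 - p)\<bar> \<le> 1" "\<bar>c * (- p)\<bar> \<le> 1"
    using p c by (auto simp: abs_mult intro: mult_le_one)
  have "measure_pmf.expectation (bernoulli_pmf p) (\<lambda>b. exp (c * (of_bool b - p)))
      = exp (c * (1 - p)) * p + exp (c * (- p)) * (1 - p)"
    using p by simp
  also have "\<dots> \<le> (1 + c * (1 - p) + (c * (1 - p))\<^sup>2) * p + (1 + c * (- p) + (c * (- p))\<^sup>2) * (1 - p)"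
    using p le by (intro add_mono mult_right_mono exp_le_one_plus_plus_square) auto
  also have "\<dots> = 1 + c\<^sup>2 * p * (1 - p)"
    by (simp add: power2_eq_square algebra_simps)
  also have "\<dots> \<le> 1 + c\<^sup>2 * p"
    using p by (auto intro!: mult_left_le)
  also have "\<dots> \<le> exp (c\<^sup>2 * p)" by simp
  finally show ?thesis .
qed

lemma finite_set_Pi_pmf_bool:
  "finite I \<Longrightarrow> finite (set_pmf (Pi_pmf I False (p :: _ \<Rightarrow> bool pmf)))"
  by (simp add: set_Pi_pmf finite_PiE_dflt)

text \<open>Exponential Markov inequality and independence; \<open>s\<close> at most 1 keeps every
  exponent in the range of the moment bound.\<close>

lemma bernoulli_chernoff:
  fixes p a :: "'a \<Rightarrow> real"
  assumes I: "finite I" and p: "\<And>e. e \<in> I \<Longrightarrow> 0 \<le> p e \<and> p e \<le> 1"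
    and a: "\<And>e. e \<in> I \<Longrightarrow> \<bar>a e\<bar> \<le> 1" and s: "0 < s" "s \<le> 1"
  shows "measure_pmf.prob (Pi_pmf I False (\<lambda>e. bernoulli_pmf (p e)))
      {E. (\<Sum>e\<in>I. a e * (of_bool (E e) - p e)) \<ge> u} \<le> exp (s\<^sup>2 * (\<Sum>e\<in>I. p e) - s * u)"
proof -
  let ?P = "Pi_pmf I False (\<lambda>e. bernoulli_pmf (p e))"
  let ?X = "\<lambda>E. \<Sum>e\<in>I. a e * (of_bool (E e) - p e)"
  have int: "integrable ?P f" for f :: "_ \<Rightarrow> real"
    by (intro integrable_measure_pmf_finite finite_set_Pi_pmf_bool I)
  have "{E. ?X E \<ge> u} = {E\<in>space ?P. exp (s * ?X E) \<ge> exp (s * u)}"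
    using s by simp
  also have "measure_pmf.prob ?P \<dots> \<le> measure_pmf.expectation ?P (\<lambda>E. exp (s * ?X E)) / exp (s * u)"
    by (intro integral_Markov_inequality_measure[where A = "{}"] int) auto
  also have "measure_pmf.expectation ?P (\<lambda>E. exp (s * ?X E))
      = measure_pmf.expectation ?P (\<lambda>E. \<Prod>e\<in>I. exp ((s * a e) * (of_bool (E e) - p e)))"
    using I by (simp add: exp_sum sum_distrib_left mult.assoc)
  also have "\<dots> = (\<Prod>e\<in>I. measure_pmf.expectation (bernoulli_pmf (p e))
      (\<lambda>b. exp ((s * a e) * (of_bool b - p e))))"
    by (rule expectation_prod_Pi_pmf[OF I]) (auto intro: integrable_measure_pmf_finite)
  also have "\<dots> \<le> (\<Prod>e\<in>I. exp (s\<^sup>2 * p e))"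
  proof (intro prod_mono conjI)
    fix e assume e: "e \<in> I"
    have "\<bar>s * a e\<bar> \<le> 1" using s a[OF e] by (auto simp: abs_mult intro: mult_le_one)
    with p[OF e] have "measure_pmf.expectation (bernoulli_pmf (p e))
        (\<lambda>b. exp ((s * a e) * (of_bool b - p e))) \<le> exp ((s * a e)\<^sup>2 * p e)"
      by (intro bernoulli_exp_moment_le) auto
    also have "(s * a e)\<^sup>2 * p e \<le> s\<^sup>2 * p e"
      using a[OF e] p[OF e] abs_square_le_1[of "a e"]
      by (auto simp: power_mult_distrib intro!: mult_right_mono mult_left_le)
    finally show "measure_pmf.expectation (bernoulli_pmf (p e))
        (\<lambda>b. exp ((s * a e) * (of_bool b - p e))) \<le> exp (s\<^sup>2 * p e)" by simp
  qed (auto intro!: Bochner_Integration.integral_nonneg)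
  also have "(\<Prod>e\<in>I. exp (s\<^sup>2 * p e)) = exp (s\<^sup>2 * (\<Sum>e\<in>I. p e))"
    using I by (simp add: exp_sum sum_distrib_left)
  finally show ?thesis by (simp add: exp_diff divide_right_mono)
qed

lemma bernoulli_signs_deviation:
  fixes p :: "'a \<Rightarrow> real" and a :: "'b \<Rightarrow> 'a \<Rightarrow> real"
  assumes I: "finite I" and p: "\<And>e. e \<in> I \<Longrightarrow> 0 \<le> p e \<and> p e \<le> 1"
    and a: "\<And>S e. e \<in> I \<Longrightarrow> \<bar>a S e\<bar> \<le> 1"
    and sum_p: "(\<Sum>e\<in>I. p e) \<le> F / 2" and F: "0 < F" and n: "0 < n"
    and T: "finite T" "card T = 2 ^ n"
  shows "measure_pmf.prob (Pi_pmf I False (\<lambda>e. bernoulli_pmf (p e)))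
      {E. \<exists>S\<in>T. \<bar>\<Sum>e\<in>I. a S e * (of_bool (E e) - p e)\<bar>
          \<ge> 5 / 2 * (sqrt (real n * F) + real n)}
      \<le> 2 * (exp 1 / 2) powr (- 2 * real n)"
proof -
  let ?P = "Pi_pmf I False (\<lambda>e. bernoulli_pmf (p e))"
  define t where "t = 5 / 2 * (sqrt (real n * F) + real n)"
  \<comment> \<open>The value sqrt (n / F) makes both s^2 F and s sqrt (n F) equal to n. It is
    capped at 1 for the moment bound; when the cap is active, the summand n of the threshold
    \<open>t\<close> suffices.\<close>
  define s where "s = min 1 (sqrt (real n / F))"
  have s: "0 < s" "s \<le> 1" using n F by (auto simp: s_def)
  have s2: "s\<^sup>2 * F \<le> real n"
  proof -
    have "s\<^sup>2 \<le> (sqrt (real n / F))\<^sup>2" using s by (intro power_mono) (auto simp: s_def)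
    then show ?thesis using F by (simp add: field_simps)
  qed
  have st: "5 / 2 * real n \<le> s * t"
  proof (cases "sqrt (real n / F) \<le> 1")
    case True
    then have "s = sqrt (real n / F)" by (simp add: s_def)
    then have "s * sqrt (real n * F) = sqrt ((real n / F) * (real n * F))"
      by (simp only: real_sqrt_mult)
    also have "\<dots> = real n" using F by simp
    finally have "s * sqrt (real n * F) = real n" .
    moreover have "0 \<le> s * real n" using s by simp
    ultimately show ?thesis by (simp add: t_def algebra_simps)
  next
    case False
    then show ?thesis using F by (simp add: s_def t_def)
  qed
  \<comment> \<open>The exponent is at most n / 2 - 5 n / 2 = -2 n, which is the reason for the
    factor 5 / 2 in \<open>t\<close>.\<close>
  have one: "measure_pmf.prob ?P {E. (\<Sum>e\<in>I. b e * (of_bool (E e) - p e)) \<ge> t} \<le> exp (- 2 * real n)"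
    if "\<And>e. e \<in> I \<Longrightarrow> \<bar>b e\<bar> \<le> 1" for b
  proof -
    have "s\<^sup>2 * (\<Sum>e\<in>I. p e) \<le> s\<^sup>2 * (F / 2)" using sum_p by (intro mult_left_mono) auto
    then have "s\<^sup>2 * (\<Sum>e\<in>I. p e) - s * t \<le> - 2 * real n" using s2 st by simp
    then show ?thesis
      using bernoulli_chernoff[where I = I and p = p and a = b and s = s and u = t, OF I p that s] by (meson exp_le_cancel_iff order.trans)
  qed
  define U where "U S = {E. (\<Sum>e\<in>I. a S e * (of_bool (E e) - p e)) \<ge> t}
      \<union> {E. (\<Sum>e\<in>I. - a S e * (of_bool (E e) - p e)) \<ge> t}" for S
  have U: "measure_pmf.prob ?P (U S) \<le> 2 * exp (- 2 * real n)" for S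
    using one[of "a S"] one[of "\<lambda>e. - a S e"] a
      measure_Un_le[of "{E. (\<Sum>e\<in>I. a S e * (of_bool (E e) - p e)) \<ge> t}" ?P
      "{E. (\<Sum>e\<in>I. - a S e * (of_bool (E e) - p e)) \<ge> t}"]
    unfolding U_def by fastforce
  have le_abs: "t \<le> \<bar>v\<bar> \<longleftrightarrow> t \<le> v \<or> t \<le> - v" for v by auto
  have "measure_pmf.prob ?P {E. \<exists>S\<in>T. \<bar>\<Sum>e\<in>I. a S e * (of_bool (E e) - p e)\<bar> \<ge> t}
      = measure_pmf.prob ?P (\<Union>S\<in>T. U S)"
    by (intro arg_cong[of _ _ "measure_pmf.prob ?P"]) (auto simp: U_def sum_negf le_abs)
  also have "\<dots> \<le> (\<Sum>S\<in>T. measure_pmf.prob ?P (U S))"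
    using T by (intro measure_UNION_le) auto
  also have "\<dots> \<le> (\<Sum>S\<in>T. 2 * exp (- 2 * real n))" by (intro sum_mono U)
  also have "\<dots> = 2 * (2 ^ n * exp (- 2 * real n))" using T by simp
  \<comment> \<open>The 2^n patterns are overcounted as 4^n, because 4^n exp (-2 n) is exactly the
    desired power of e / 2.\<close>
  also have "2 ^ n * exp (- 2 * real n) \<le> (2 powr (2 * real n)) * exp (- 2 * real n)"
    by (simp add: powr_realpow[symmetric])
  also have "\<dots> = (exp 1 / 2) powr (- 2 * real n)"
    by (simp add: powr_def ln_div algebra_simps flip: exp_add)
  finally show ?thesis unfolding t_def by simp
qed

lemma bernoulli_sum_markov:
  fixes p :: "'a \<Rightarrow> real"
  assumes I: "finite I" and p: "\<And>e. e \<in> I \<Longrightarrow> 0 \<le> p e \<and> p e \<le> 1"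
    and sum_p: "(\<Sum>e\<in>I. p e) \<le> F" and F: "0 < F" and c: "0 < c"
  shows "measure_pmf.prob (Pi_pmf I False (\<lambda>e. bernoulli_pmf (p e)))
      {E. (\<Sum>e\<in>I. of_bool (E e)) \<ge> c * F} \<le> 1 / c"
proof -
  let ?P = "Pi_pmf I False (\<lambda>e. bernoulli_pmf (p e))"
  have int: "integrable ?P f" for f :: "_ \<Rightarrow> real"
    by (intro integrable_measure_pmf_finite finite_set_Pi_pmf_bool I)
  have comp: "measure_pmf.expectation ?P (\<lambda>E. of_bool (E e)) = p e" if e: "e \<in> I" for e
  proof -
    have "measure_pmf.expectation ?P (\<lambda>E. of_bool (E e) :: real)
        = measure_pmf.expectation (map_pmf (\<lambda>E. E e) ?P) of_bool"
      by simp
    also have "\<dots> = p e"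
      using Pi_pmf_component[OF I, of e False "\<lambda>e. bernoulli_pmf (p e)"] e p[OF e] by simp
    finally show ?thesis .
  qed
  have "measure_pmf.prob ?P {E\<in>space ?P. (\<Sum>e\<in>I. of_bool (E e)) \<ge> c * F}
      \<le> measure_pmf.expectation ?P (\<lambda>E. \<Sum>e\<in>I. of_bool (E e)) / (c * F)"
    using F c by (intro integral_Markov_inequality_measure[where A = "{}"] int) (auto intro!: sum_nonneg)
  also have "measure_pmf.expectation ?P (\<lambda>E. \<Sum>e\<in>I. of_bool (E e)) = (\<Sum>e\<in>I. p e)"
    using comp by (subst Bochner_Integration.integral_sum) (auto intro: int)
  also have "\<dots> / (c * F) \<le> F / (c * F)"
    using sum_p F c by (intro divide_right_mono) auto
  finally show ?thesis using F by simp
qed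

section \<open>The degree-corrected stochastic block model\<close>

lemma finite_node_pairs: "finite (node_pairs n)"
  by (rule finite_subset[of _ "{1..n} \<times> {1..n}"]) (auto simp: node_pairs_def)

text \<open>The index square consists of the pairs above the diagonal, their mirror images and the
  diagonal. This links sums over matrices to sums over independent edges.\<close>

lemma sum_node_pairs:
  fixes g :: "nat \<Rightarrow> nat \<Rightarrow> real"
  assumes sym: "\<And>i j. i \<in> {1..n} \<Longrightarrow> j \<in> {1..n} \<Longrightarrow> g i j = g j i"
    and diag: "\<And>i. i \<in> {1..n} \<Longrightarrow> g i i = 0"
  shows "(\<Sum>i=1..n. \<Sum>j=1..n. g i j) = 2 * (\<Sum>(i, j)\<in>node_pairs n. g i j)"
proof -
  let ?N = "node_pairs n" and ?M = "prod.swap ` node_pairs n" and ?D = "(\<lambda>i. (i, i)) ` {1..n}"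
  have split: "{1..n} \<times> {1..n} = (?N \<union> ?M) \<union> ?D"
    by (auto simp: node_pairs_def image_iff)
  have "(\<Sum>i=1..n. \<Sum>j=1..n. g i j) = (\<Sum>(i, j)\<in>(?N \<union> ?M) \<union> ?D. g i j)"
    unfolding split[symmetric] by (simp add: sum.cartesian_product)
  also have "\<dots> = (\<Sum>(i, j)\<in>?N. g i j) + (\<Sum>(i, j)\<in>?M. g i j) + (\<Sum>(i, j)\<in>?D. g i j)"
    using finite_node_pairs by (subst sum.union_disjoint, (auto simp: node_pairs_def)[3])+ simp
  also have "(\<Sum>(i, j)\<in>?D. g i j) = 0"
    using diag by (intro sum.neutral) auto
  also have "(\<Sum>(i, j)\<in>?M. g i j) = (\<Sum>(i, j)\<in>?N. g i j)"
    by (subst sum.reindex) (auto simp: node_pairs_def intro!: sum.cong sym)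
  finally show ?thesis by simp
qed

definition adjacency :: "(nat \<times> nat \<Rightarrow> bool) \<Rightarrow> nat \<Rightarrow> nat \<Rightarrow> real" where
  "adjacency E i j = of_bool (E (i, j) \<or> E (j, i))"

text \<open>Indexing by subsets lets the union bound run over the finite set
  \<open>Pow {1..n}\<close>.\<close>

definition sign_vec :: "nat set \<Rightarrow> nat \<Rightarrow> real" where
  "sign_vec S i = (if i \<in> S then 1 else - 1)"

section \<open>Clusters, edge probabilities and noise\<close>

locale dcsbm_setting =
  fixes n r :: nat and C :: "nat \<Rightarrow> nat set" and \<theta> :: "nat \<Rightarrow> real" and B :: "nat \<Rightarrow> nat \<Rightarrow> real"
  assumes params: "dcsbm_params n r C \<theta> B"
begin

abbreviation cl :: "nat \<Rightarrow> nat" where "cl \<equiv> cluster_of r C"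
abbreviation Hc :: "nat \<Rightarrow> real" where "Hc \<equiv> H r C \<theta> B"
abbreviation f :: "nat \<Rightarrow> real" where "f \<equiv> f_vec r C \<theta> B"
abbreviation F :: real where "F \<equiv> l1_norm n f"
abbreviation Ystar :: "nat \<Rightarrow> nat \<Rightarrow> real" where "Ystar \<equiv> true_partition_matrix r C"

text \<open>The diagonal is kept although there are no loops: with it the row sums are exactly
  \<open>f\<close>.\<close>

definition edge_prob :: "nat \<Rightarrow> nat \<Rightarrow> real" where
  "edge_prob i j = \<theta> i * \<theta> j * B (cl i) (cl j)"

text \<open>The zero diagonal is what the reduction to sign vectors requires.\<close>

definition noise :: "(nat \<Rightarrow> nat \<Rightarrow> real) \<Rightarrow> nat \<Rightarrow> nat \<Rightarrow> real" where
  "noise A i j = (if i = j then 0 else A i j - edge_prob i j)"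

lemma n_pos: "0 < n"
  using params by (simp add: dcsbm_params_def)

lemma C_subset: "a \<in> {1..r} \<Longrightarrow> C a \<subseteq> {1..n}"
  using params by (auto simp: dcsbm_params_def partition_on_def)

lemma cluster_ofI:
  assumes "a \<in> {1..r}" "i \<in> C a"
  shows "cl i = a"
  unfolding cluster_of_def
proof (rule the_equality)
  fix b assume b: "b \<in> {1..r} \<and> i \<in> C b"
  have "C b = C a"
    using params assms b disjointD[of "C ` {1..r}" "C b" "C a"]
    unfolding dcsbm_params_def partition_on_def by blast
  then show "b = a"
    using params assms b by (auto simp: dcsbm_params_def dest: inj_onD)
qed (use assms in simp)

lemma cluster_of:
  assumes "i \<in> {1..n}"
  shows "cl i \<in> {1..r}" "i \<in> C (cl i)"
proof -
  have "i \<in> \<Union> (C ` {1..r})"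
    using params assms by (simp add: dcsbm_params_def partition_on_def)
  then obtain a where "a \<in> {1..r}" "i \<in> C a" by auto
  then show "cl i \<in> {1..r}" "i \<in> C (cl i)" using cluster_ofI by auto
qed

lemma C_eq: "a \<in> {1..r} \<Longrightarrow> C a = {i\<in>{1..n}. cl i = a}"
  using C_subset cluster_ofI cluster_of by blast

lemma theta_nonneg: "i \<in> {1..n} \<Longrightarrow> 0 \<le> \<theta> i"
  using params by (simp add: dcsbm_params_def)

lemma B_nonneg: "a \<in> {1..r} \<Longrightarrow> b \<in> {1..r} \<Longrightarrow> 0 \<le> B a b"
  using params by (simp add: dcsbm_params_def)

lemma B_sym: "a \<in> {1..r} \<Longrightarrow> b \<in> {1..r} \<Longrightarrow> B a b = B b a"
  using params by (simp add: dcsbm_params_def symmetric_on_def)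

lemma edge_prob_bounds:
  assumes "i \<in> {1..n}" "j \<in> {1..n}"
  shows "0 \<le> edge_prob i j" "edge_prob i j \<le> 1"
proof -
  show "0 \<le> edge_prob i j"
    unfolding edge_prob_def using assms theta_nonneg B_nonneg cluster_of
    by (intro mult_nonneg_nonneg) auto
  have "\<forall>a\<in>{1..r}. \<forall>b\<in>{1..r}. \<forall>i\<in>C a. \<forall>j\<in>C b. \<theta> i * \<theta> j * B a b \<le> 1"
    using params by (simp add: dcsbm_params_def)
  then show "edge_prob i j \<le> 1"
    unfolding edge_prob_def using cluster_of assms by blast
qed

lemma edge_prob_sym: "i \<in> {1..n} \<Longrightarrow> j \<in> {1..n} \<Longrightarrow> edge_prob i j = edge_prob j i"
  using B_sym[of "cl i" "cl j"] cluster_of by (simp add: edge_prob_def)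

lemma sum_edge_prob:
  assumes "i \<in> {1..n}"
  shows "(\<Sum>j=1..n. edge_prob i j) = f i"
proof -
  have "(\<Sum>j=1..n. \<theta> j * B (cl i) (cl j))
      = (\<Sum>b=1..r. \<Sum>j\<in>{j\<in>{1..n}. cl j = b}. \<theta> j * B (cl i) (cl j))"
    by (rule sum.group[symmetric]) (use cluster_of in auto)
  also have "\<dots> = (\<Sum>b=1..r. B (cl i) b * G C \<theta> b)"
    by (intro sum.cong refl) (auto simp: G_def C_eq sum_distrib_left mult.commute intro!: sum.cong)
  finally have "\<theta> i * (\<Sum>j=1..n. \<theta> j * B (cl i) (cl j)) = f i"
    by (simp only: f_vec_def H_def)
  then show ?thesis by (simp only: edge_prob_def mult.assoc sum_distrib_left)
qed

lemma H_nonneg: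
  assumes "a \<in> {1..r}"
  shows "0 \<le> Hc a"
proof -
  have "0 \<le> G C \<theta> b" if "b \<in> {1..r}" for b
    unfolding G_def using theta_nonneg C_subset[OF that] by (intro sum_nonneg) blast
  then show ?thesis
    unfolding H_def using B_nonneg assms by (intro sum_nonneg mult_nonneg_nonneg) auto
qed

lemma f_nonneg: "i \<in> {1..n} \<Longrightarrow> 0 \<le> f i"
  unfolding f_vec_def using theta_nonneg H_nonneg cluster_of by simp

lemma F_eq: "F = (\<Sum>i=1..n. f i)"
  using f_nonneg by (simp add: l1_norm_def)

lemma true_partition_eq:
  assumes "i \<in> {1..n}" "j \<in> {1..n}"
  shows "Ystar i j = of_bool (cl i = cl j)"
proof -
  have "(\<exists>a\<in>{1..r}. i \<in> C a \<and> j \<in> C a) \<longleftrightarrow> cl i = cl j"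
  proof
    assume "\<exists>a\<in>{1..r}. i \<in> C a \<and> j \<in> C a"
    then show "cl i = cl j" using cluster_ofI by blast
  next
    assume "cl i = cl j"
    then show "\<exists>a\<in>{1..r}. i \<in> C a \<and> j \<in> C a"
      using cluster_of[OF assms(1)] cluster_of[OF assms(2)] by auto
  qed
  then show ?thesis by (simp add: true_partition_matrix_def)
qed

text \<open>The matrix is the sum over clusters of the outer products of their indicator vectors,
  hence positive semidefinite. Feasibility makes it a competitor of the solution.\<close>

lemma feasible_true_partition: "feasible n Ystar"
proof -
  have r: "0 < r" using n_pos cluster_of[of 1] by auto
  \<comment> \<open>The factor \<open>real r\<close> undoes the division by the length of the
    list.\<close>
  define g where
    "g i j = real r * avg [1..<Suc r] (\<lambda>a. of_bool (cl i = a) * of_bool (cl j = a))" for i j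
  have Ystar: "Ystar i j = g i j"
    if "i \<in> {1..n}" "j \<in> {1..n}" for i j
  proof -
    have "(\<Sum>a\<leftarrow>[1..<Suc r]. of_bool (cl i = a) * of_bool (cl j = a) :: real)
        = (\<Sum>a=1..r. of_bool (cl i = a) * of_bool (cl j = a))"
      by (simp add: sum_list_distinct_conv_sum_set atLeastLessThanSuc_atLeastAtMost del: upt_Suc)
    also have "\<dots> = (\<Sum>a=1..r. if cl i = a then of_bool (cl i = cl j) else 0)"
      by (intro sum.cong) auto
    also have "\<dots> = of_bool (cl i = cl j)"
      using cluster_of(1)[OF that(1)] by (subst sum.delta') auto
    finally show ?thesis using r true_partition_eq[OF that] by (simp add: g_def avg_def del: upt_Suc)
  qed
  have "psd n g"
    unfolding g_def using r by (intro psd_cmult psd_avg_outer) auto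
  moreover have "quad_form n Ystar x = quad_form n g x" for x
    unfolding quad_form_def by (intro sum.cong refl) (simp only: Ystar)
  ultimately have "psd n Ystar" by (simp add: psd_iff_quad_form symmetric_on_def Ystar)
  then show ?thesis by (simp add: feasible_def true_partition_eq)
qed

section \<open>The deterministic error bound\<close>

lemma degree_deviation:
  assumes sym: "symmetric_on n A" and diag: "\<And>i. i \<in> {1..n} \<Longrightarrow> A i i = 0"
    and K: "\<And>x. x \<in> cube n \<Longrightarrow> \<bar>quad_form n (noise A) x\<bar> \<le> K"
  shows "(\<Sum>i=1..n. \<bar>degree n A i - f i\<bar>) \<le> 2 * K + real n"
proof -
  \<comment> \<open>The summand 1 pays for the diagonal entry of \<open>edge_prob\<close>, which is
    part of \<open>f i\<close> but not of the noise.\<close>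
  have "\<bar>degree n A i - f i\<bar> \<le> \<bar>\<Sum>j=1..n. noise A i j\<bar> + 1" if i: "i \<in> {1..n}" for i
  proof -
    have "degree n A i - f i = (\<Sum>j=1..n. A i j - edge_prob i j)"
      using sum_edge_prob[OF i] by (simp add: degree_def sum_subtractf)
    also have "\<dots> = (\<Sum>j=1..n. noise A i j - (if j = i then edge_prob i i else 0))"
      using diag by (intro sum.cong) (auto simp: noise_def)
    also have "\<dots> = (\<Sum>j=1..n. noise A i j) - edge_prob i i"
      using i by (simp add: sum_subtractf)
    finally show ?thesis using edge_prob_bounds[OF i i] by simp
  qed
  then have "(\<Sum>i=1..n. \<bar>degree n A i - f i\<bar>) \<le> (\<Sum>i=1..n. \<bar>\<Sum>j=1..n. noise A i j\<bar> + 1)"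
    by (intro sum_mono) auto
  also have "\<dots> = (\<Sum>i=1..n. \<bar>\<Sum>j=1..n. noise A i j\<bar>) + real n"
    by (simp add: sum.distrib)
  also have "symmetric_on n (noise A)"
    using sym edge_prob_sym by (auto simp: symmetric_on_def noise_def)
  from sum_abs_rows_le[OF this K]
  have "(\<Sum>i=1..n. \<bar>\<Sum>j=1..n. noise A i j\<bar>) + real n \<le> 2 * K + real n" by simp
  finally show ?thesis .
qed

lemma deterministic_bound:
  assumes \<delta>: "0 < \<delta>" and lam: "0 \<le> lam"
    and within: "\<And>a. a \<in> {1..r} \<Longrightarrow> \<delta> \<le> B a a - lam * (Hc a * Hc a)"
    and between: "\<And>a b. a \<in> {1..r} \<Longrightarrow> b \<in> {1..r} \<Longrightarrow> a \<noteq> b \<Longrightarrow> \<delta> \<le> lam * (Hc a * Hc b) - B a b"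
    and A: "symmetric_on n A" "\<And>i. i \<in> {1..n} \<Longrightarrow> A i i = 0" "\<And>i j. 0 \<le> A i j"
    and K: "\<And>x. x \<in> cube n \<Longrightarrow> \<bar>quad_form n (noise A) x\<bar> \<le> K"
    and D: "(\<Sum>i=1..n. degree n A i) \<le> D"
    and Y: "solution n lam A Y"
  shows "\<delta> * weighted_l1_norm n \<theta> (\<lambda>i j. Ystar i j - Y i j)
    \<le> 100 * K + lam * ((2 * K + real n) * (D + F))"
proof -
  let ?d = "degree n A"
  define \<Delta> where "\<Delta> i j = Y i j - Ystar i j" for i j
  have Yf: "feasible n Y" using Y by (simp add: solution_def is_arg_max_def)
  have Yp: "psd n Y" "\<And>i. i \<in> {1..n} \<Longrightarrow> Y i i = 1"
    "\<And>i j. i \<in> {1..n} \<Longrightarrow> j \<in> {1..n} \<Longrightarrow> 0 \<le> Y i j \<and> Y i j \<le> 1"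
    using Yf by (auto simp: feasible_def)
  have Sp: "psd n Ystar" using feasible_true_partition by (simp add: feasible_def)
  have d_nonneg: "0 \<le> ?d i" for i using A(3) by (simp add: degree_def sum_nonneg)
  have opt: "0 \<le> (\<Sum>i=1..n. \<Sum>j=1..n. \<Delta> i j * (A i j - lam * (?d i * ?d j)))"
  proof -
    have "trace_inner n Ystar (\<lambda>i j. A i j - lam * (?d i * ?d j))
        \<le> trace_inner n Y (\<lambda>i j. A i j - lam * (?d i * ?d j))"
      using Y feasible_true_partition by (auto simp: solution_def is_arg_max_def not_less)
    then show ?thesis
      by (simp add: trace_inner_def \<Delta>_def left_diff_distrib sum_subtractf)
  qed
  \<comment> \<open>As \<open>Ystar\<close> is 0 or 1 and \<open>Y\<close> lies in between,
    \<open>\<Delta>\<close> is nonpositive within clusters and nonnegative between them, opposite to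
    the sign of the gap; hence no cancellation occurs.\<close>
  have gap: "\<delta> * \<bar>\<theta> i * (Ystar i j - Y i j) * \<theta> j\<bar> \<le> - \<Delta> i j * (edge_prob i j - lam * (f i * f j))"
    if i: "i \<in> {1..n}" and j: "j \<in> {1..n}" for i j
  proof -
    define w where "w = \<theta> i * \<theta> j"
    define g where "g = B (cl i) (cl j) - lam * (Hc (cl i) * Hc (cl j))"
    have w: "0 \<le> w" using theta_nonneg i j by (simp add: w_def)
    have rhs: "edge_prob i j - lam * (f i * f j) = w * g"
      by (simp add: edge_prob_def f_vec_def w_def g_def algebra_simps)
    have lhs: "\<bar>\<theta> i * (Ystar i j - Y i j) * \<theta> j\<bar> = w * \<bar>\<Delta> i j\<bar>"
      using theta_nonneg[OF i] theta_nonneg[OF j]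
      by (simp add: abs_mult w_def \<Delta>_def abs_minus_commute)
    have "\<delta> * \<bar>\<Delta> i j\<bar> \<le> - \<Delta> i j * g"
    proof (cases "cl i = cl j")
      case True
      have "\<delta> \<le> g" using within[of "cl j"] True cluster_of[OF j] by (simp add: g_def)
      moreover have "\<bar>\<Delta> i j\<bar> = - \<Delta> i j"
        using Yp(3)[OF i j] True by (simp add: \<Delta>_def true_partition_eq[OF i j])
      ultimately show ?thesis by (metis abs_ge_zero mult.commute mult_left_mono)
    next
      case False
      have "\<delta> \<le> - g"
        using between[of "cl i" "cl j"] False cluster_of[OF i] cluster_of[OF j] by (simp add: g_def)
      moreover have "\<bar>\<Delta> i j\<bar> = \<Delta> i j"
        using Yp(3)[OF i j] False by (simp add: \<Delta>_def true_partition_eq[OF i j])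
      ultimately have "\<bar>\<Delta> i j\<bar> * \<delta> \<le> \<Delta> i j * (- g)" by (metis abs_ge_zero mult_left_mono)
      then show ?thesis by (simp add: mult.commute)
    qed
    from mult_left_mono[OF this w] show ?thesis unfolding lhs rhs by (simp add: ac_simps)
  qed
  have "\<delta> * weighted_l1_norm n \<theta> (\<lambda>i j. Ystar i j - Y i j)
      \<le> (\<Sum>i=1..n. \<Sum>j=1..n. - \<Delta> i j * (edge_prob i j - lam * (f i * f j)))"
    unfolding weighted_l1_norm_def sum_distrib_left by (intro sum_mono gap) auto
  \<comment> \<open>Optimality enters as a nonnegative term; adding it turns the edge probabilities
    into noise and \<open>f\<close> into a difference from the degrees.\<close>
  also have "\<dots> \<le> (\<Sum>i=1..n. \<Sum>j=1..n. - \<Delta> i j * (edge_prob i j - lam * (f i * f j)))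
      + (\<Sum>i=1..n. \<Sum>j=1..n. \<Delta> i j * (A i j - lam * (?d i * ?d j)))"
    using opt by simp
  also have "\<dots> = (\<Sum>i=1..n. \<Sum>j=1..n. \<Delta> i j * noise A i j)
      + lam * (\<Sum>i=1..n. \<Sum>j=1..n. - \<Delta> i j * (?d i * ?d j - f i * f j))"
    unfolding sum.distrib[symmetric] sum_distrib_left
  proof (intro sum.cong refl)
    fix i j assume "i \<in> {1..n}" "j \<in> {1..n}"
    \<comment> \<open>The diagonal of \<open>edge_prob\<close>, absent from \<open>noise\<close>,
      does no harm because both matrices have unit diagonal.\<close>
    then have "i = j \<Longrightarrow> \<Delta> i j = 0" using Yp(2) by (simp add: \<Delta>_def true_partition_eq)
    then show "- \<Delta> i j * (edge_prob i j - lam * (f i * f j))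
        + \<Delta> i j * (A i j - lam * (?d i * ?d j))
        = \<Delta> i j * noise A i j + lam * (- \<Delta> i j * (?d i * ?d j - f i * f j))"
      by (auto simp: noise_def algebra_simps)
  qed
  also have "\<dots> \<le> 100 * K + lam * ((2 * K + real n) * (D + F))"
  proof (intro add_mono mult_left_mono lam)
    have "(\<Sum>i=1..n. \<Sum>j=1..n. \<Delta> i j * noise A i j)
        = trace_inner n (noise A) Y - trace_inner n (noise A) Ystar"
      by (simp add: trace_inner_def \<Delta>_def right_diff_distrib sum_subtractf mult.commute)
    moreover have "\<bar>trace_inner n (noise A) Y\<bar> \<le> 50 * K"
      by (rule grothendieck_psd[OF K Yp(1)]) (use Yp(2) in auto)
    moreover have "\<bar>trace_inner n (noise A) Ystar\<bar> \<le> 50 * K"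
      by (rule grothendieck_psd[OF K Sp]) (auto simp: true_partition_eq)
    ultimately show "(\<Sum>i=1..n. \<Sum>j=1..n. \<Delta> i j * noise A i j) \<le> 100 * K" by linarith
  next
    let ?e = "\<lambda>i. \<bar>?d i - f i\<bar>"
    have "(\<Sum>i=1..n. \<Sum>j=1..n. - \<Delta> i j * (?d i * ?d j - f i * f j))
        \<le> (\<Sum>i=1..n. \<Sum>j=1..n. ?e i * ?d j + f i * ?e j)"
    proof (intro sum_mono)
      fix i j assume ij: "i \<in> {1..n}" "j \<in> {1..n}"
      \<comment> \<open>Changing one factor at a time leaves double sums that split into products of
        l1 norms.\<close>
      have "?d i * ?d j - f i * f j = (?d i - f i) * ?d j + f i * (?d j - f j)"
        by (simp add: algebra_simps)
      then have "\<bar>?d i * ?d j - f i * f j\<bar> \<le> ?e i * ?d j + f i * ?e j"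
        using d_nonneg[of j] f_nonneg[OF ij(1)]
          abs_triangle_ineq[of "(?d i - f i) * ?d j" "f i * (?d j - f j)"]
        by (simp add: abs_mult)
      moreover have "- \<Delta> i j * (?d i * ?d j - f i * f j) \<le> \<bar>\<Delta> i j\<bar> * \<bar>?d i * ?d j - f i * f j\<bar>"
        by (metis abs_ge_self abs_minus_cancel abs_mult)
      moreover have "\<bar>\<Delta> i j\<bar> * \<bar>?d i * ?d j - f i * f j\<bar> \<le> 1 * \<bar>?d i * ?d j - f i * f j\<bar>"
        using Yp(3)[OF ij] by (intro mult_right_mono) (auto simp: \<Delta>_def true_partition_eq[OF ij])
      ultimately show "- \<Delta> i j * (?d i * ?d j - f i * f j) \<le> ?e i * ?d j + f i * ?e j"
        by linarith
    qed
    also have "\<dots> = (\<Sum>i=1..n. ?e i) * ((\<Sum>i=1..n. ?d i) + F)"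
    proof -
      have "(\<Sum>i=1..n. \<Sum>j=1..n. ?e i * ?d j) = (\<Sum>i=1..n. ?e i) * (\<Sum>i=1..n. ?d i)"
        "(\<Sum>i=1..n. \<Sum>j=1..n. f i * ?e j) = F * (\<Sum>i=1..n. ?e i)"
        by (simp_all only: F_eq sum_product)
      then show ?thesis by (simp only: sum.distrib ring_distribs mult.commute)
    qed
    also have "\<dots> \<le> (2 * K + real n) * (D + F)"
    proof (intro mult_mono)
      show "(\<Sum>i=1..n. ?e i) \<le> 2 * K + real n" by (rule degree_deviation[OF A(1,2) K])
      then show "0 \<le> 2 * K + real n" by (meson abs_ge_zero order.trans sum_nonneg)
      show "0 \<le> (\<Sum>i=1..n. ?d i) + F"
        using d_nonneg f_nonneg by (auto simp: F_eq intro!: add_nonneg_nonneg sum_nonneg)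
    qed (use D in simp)
    finally show "(\<Sum>i=1..n. \<Sum>j=1..n. - \<Delta> i j * (?d i * ?d j - f i * f j))
        \<le> (2 * K + real n) * (D + F)" .
  qed
  finally show ?thesis .
qed


section \<open>The random graph and the recovery probability\<close>

definition edge_law :: "(nat \<times> nat \<Rightarrow> bool) pmf" where
  "edge_law = Pi_pmf (node_pairs n) False (\<lambda>e. bernoulli_pmf (edge_prob (fst e) (snd e)))"

lemma dcsbm_eq: "dcsbm n r C \<theta> B = map_pmf adjacency edge_law"
  unfolding dcsbm_def edge_law_def adjacency_def edge_prob_def by (simp only: case_prod_unfold)

lemma edge_law_support:
  assumes "E \<in> set_pmf edge_law" "e \<notin> node_pairs n"
  shows "\<not> E e"
  using subsetD[OF set_Pi_pmf_subset[OF finite_node_pairs] assms(1)[unfolded edge_law_def]] assms(2)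
  by (cases e) simp

text \<open>For i < j the reversed pair lies outside \<open>node_pairs\<close>, where every
  \<open>E\<close> in the support is \<open>False\<close>; so a single indicator decides the
  entry.\<close>

lemma adjacency_props:
  assumes "E \<in> set_pmf edge_law"
  shows "symmetric_on n (adjacency E)" "adjacency E i i = 0" "0 \<le> adjacency E i j"
    "(i, j) \<in> node_pairs n \<Longrightarrow> adjacency E i j = of_bool (E (i, j))"
  using edge_law_support[OF assms, of "(i, i)"] edge_law_support[OF assms, of "(j, i)"]
  by (auto simp: symmetric_on_def adjacency_def node_pairs_def)

lemma edge_prob_pair: "e \<in> node_pairs n \<Longrightarrow> 0 \<le> edge_prob (fst e) (snd e) \<and> edge_prob (fst e) (snd e) \<le> 1"
  using edge_prob_bounds[of "fst e" "snd e"] by (auto simp: node_pairs_def)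

text \<open>Each unordered pair counts once, hence the half; dropping the nonnegative diagonal makes
  this an inequality.\<close>

lemma sum_edge_prob_pairs: "(\<Sum>e\<in>node_pairs n. edge_prob (fst e) (snd e)) \<le> F / 2"
proof -
  let ?g = "\<lambda>i j. if i = j then 0 else edge_prob i j"
  have "2 * (\<Sum>e\<in>node_pairs n. edge_prob (fst e) (snd e)) = 2 * (\<Sum>(i, j)\<in>node_pairs n. ?g i j)"
    by (intro arg_cong[of _ _ "(*) 2"] sum.cong) (auto simp: node_pairs_def)
  also have "\<dots> = (\<Sum>i=1..n. \<Sum>j=1..n. ?g i j)"
    using edge_prob_sym by (intro sum_node_pairs[symmetric]) auto
  also have "\<dots> \<le> (\<Sum>i=1..n. \<Sum>j=1..n. edge_prob i j)"
    using edge_prob_bounds by (intro sum_mono) auto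
  also have "\<dots> = F" using sum_edge_prob by (simp add: F_eq)
  finally show ?thesis by simp
qed

text \<open>Every edge occurs twice in the form, hence the factor 2. The reduction to sign vectors
  is one-sided, so it is applied to the noise and to its negative.\<close>

lemma noise_quad_form_bound:
  assumes E: "E \<in> set_pmf edge_law"
    and t: "\<And>S. S \<subseteq> {1..n} \<Longrightarrow> \<bar>\<Sum>e\<in>node_pairs n. sign_vec S (fst e) * sign_vec S (snd e)
      * (of_bool (E e) - edge_prob (fst e) (snd e))\<bar> \<le> t"
    and x: "x \<in> cube n"
  shows "\<bar>quad_form n (noise (adjacency E)) x\<bar> \<le> 2 * t"
proof -
  let ?W = "noise (adjacency E)"
  have sym: "symmetric_on n ?W"
    using adjacency_props(1)[OF E] edge_prob_sym by (auto simp: symmetric_on_def noise_def)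
  have diag: "?W i i = 0" for i by (simp add: noise_def)
  have sgn: "\<bar>quad_form n ?W s\<bar> \<le> 2 * t" if s: "\<forall>i\<in>{1..n}. s i \<in> {-1, 1}" for s
  proof -
    define S where "S = {i\<in>{1..n}. s i = 1}"
    have s_eq: "s i = sign_vec S i" if "i \<in> {1..n}" for i
      using s that by (auto simp: S_def sign_vec_def)
    have "quad_form n ?W s = 2 * (\<Sum>(i, j)\<in>node_pairs n. s i * ?W i j * s j)"
      unfolding quad_form_def
      by (rule sum_node_pairs) (use sym diag in \<open>auto simp: symmetric_on_def\<close>)
    also have "(\<Sum>(i, j)\<in>node_pairs n. s i * ?W i j * s j)
        = (\<Sum>e\<in>node_pairs n. sign_vec S (fst e) * sign_vec S (snd e)
            * (of_bool (E e) - edge_prob (fst e) (snd e)))"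
    proof (intro sum.cong refl)
      fix e assume e: "e \<in> node_pairs n"
      obtain i j where ij: "e = (i, j)" by fastforce
      have "i \<in> {1..n}" "j \<in> {1..n}" "i \<noteq> j" using e by (auto simp: node_pairs_def ij)
      then show "(case e of (i, j) \<Rightarrow> s i * ?W i j * s j)
          = sign_vec S (fst e) * sign_vec S (snd e) * (of_bool (E e) - edge_prob (fst e) (snd e))"
        using adjacency_props(4)[OF E, of i j] e by (simp add: ij noise_def s_eq)
    qed
    moreover have "S \<subseteq> {1..n}" by (auto simp: S_def)
    ultimately show ?thesis using t[of S] by (simp only: abs_mult) simp
  qed
  have neg: "quad_form n (\<lambda>i j. - ?W i j) y = - quad_form n ?W y" for y
    by (simp add: quad_form_def sum_negf)
  obtain s where s: "\<forall>i\<in>{1..n}. s i \<in> {-1, 1}" "quad_form n ?W x \<le> quad_form n ?W s"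
    using quad_form_le_sign_vector[OF sym diag x] by blast
  have "symmetric_on n (\<lambda>i j. - ?W i j)" using sym by (simp add: symmetric_on_def)
  from quad_form_le_sign_vector[OF this _ x] diag
  obtain s' where s': "\<forall>i\<in>{1..n}. s' i \<in> {-1, 1}" "- quad_form n ?W x \<le> - quad_form n ?W s'"
    unfolding neg by auto
  show ?thesis using sgn[OF s(1)] sgn[OF s'(1)] s(2) s'(2) by linarith
qed

lemma recovery_bound:
  assumes \<delta>: "0 < \<delta>"
    and upper: "max_between r (\<lambda>a b. (B a b + \<delta>) / (Hc a * Hc b)) < lam"
    and lower: "lam < min_within r (\<lambda>a. (B a a - \<delta>) / (Hc a)\<^sup>2)"
  shows "measure_pmf.prob (dcsbm n r C \<theta> B)
      {A. \<forall>Y. solution n lam A Y \<longrightarrow>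
        weighted_l1_norm n \<theta> (\<lambda>i j. Ystar i j - Y i j)
          \<le> 1111 / \<delta> * (1 + min_within r (\<lambda>a. B a a / (Hc a)\<^sup>2) * F) * (sqrt (real n * F) + real n)}
      \<ge> 0.99 - 2 * (exp 1 / 2) powr (- 2 * real n)"
proof -
  define R where "R = sqrt (real n * F) + real n"
  define m where "m = min_within r (\<lambda>a. B a a / (Hc a)\<^sup>2)"
  have r: "1 \<in> {1..r}" using n_pos cluster_of[of 1] by auto
  have "{(B a b + \<delta>) / (Hc a * Hc b) | a b. 1 \<le> a \<and> a < b \<and> b \<le> r}
      \<subseteq> (\<lambda>(a, b). (B a b + \<delta>) / (Hc a * Hc b)) ` ({1..r} \<times> {1..r})"
    by force
  from finite_subset[OF this]
  have fin: "finite {(B a b + \<delta>) / (Hc a * Hc b) | a b. 1 \<le> a \<and> a < b \<and> b \<le> r}" by simp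
  \<comment> \<open>As \<open>max_between\<close> includes 0, \<open>lam\<close> is positive even
    for a single cluster.\<close>
  from upper have lam: "0 < lam"
    and up: "\<And>a b. 1 \<le> a \<Longrightarrow> a < b \<Longrightarrow> b \<le> r \<Longrightarrow> (B a b + \<delta>) / (Hc a * Hc b) < lam"
    using fin by (auto simp: max_between_def)
  have low: "lam < (B a a - \<delta>) / (Hc a)\<^sup>2" if "a \<in> {1..r}" for a
    using lower that r by (auto simp: min_within_def)
  have H_pos: "0 < Hc a" if "a \<in> {1..r}" for a
  proof -
    \<comment> \<open>Division by zero yields 0, so a vanishing \<open>Hc a\<close> would force
      \<open>lam\<close> below 0.\<close>
    have "Hc a \<noteq> 0" using low[OF that] lam by auto
    then show ?thesis using H_nonneg[OF that] by simp
  qed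
  have within: "\<delta> \<le> B a a - lam * (Hc a * Hc a)" if "a \<in> {1..r}" for a
    using low[OF that] H_pos[OF that] by (simp add: field_simps power2_eq_square)
  have less: "\<delta> \<le> lam * (Hc a * Hc b) - B a b" if "a \<in> {1..r}" "b \<in> {1..r}" "a < b" for a b
    using up[of a b] that H_pos[OF that(1)] H_pos[OF that(2)] by (simp add: divide_less_eq)
  have between: "\<delta> \<le> lam * (Hc a * Hc b) - B a b"
    if "a \<in> {1..r}" "b \<in> {1..r}" "a \<noteq> b" for a b
    using less[OF that(1,2)] less[OF that(2,1)] that(3) B_sym[OF that(1,2)]
    by (cases "a < b") (simp_all add: mult.commute)
  have m: "lam \<le> m"
  proof -
    have "lam \<le> B a a / (Hc a)\<^sup>2" if "a \<in> {1..r}" for a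
    proof -
      have "(B a a - \<delta>) / (Hc a)\<^sup>2 \<le> B a a / (Hc a)\<^sup>2"
        using \<delta> by (intro divide_right_mono) auto
      then show ?thesis using low[OF that] by simp
    qed
    then show ?thesis using r by (auto simp: m_def min_within_def)
  qed
  have F: "0 < F"
  proof -
    \<comment> \<open>A node of maximal weight 1 already contributes a positive
      \<open>f i\<close>.\<close>
    have "Max (\<theta> ` {1..n}) \<in> \<theta> ` {1..n}" using n_pos by (intro Max_in) auto
    then obtain i where i: "i \<in> {1..n}" "\<theta> i = 1"
      using params by (auto simp: dcsbm_params_def)
    then have "0 < f i" using H_pos cluster_of by (simp add: f_vec_def)
    then show ?thesis
      unfolding F_eq using i(1) f_nonneg by (intro sum_pos2) auto
  qed
  have R: "real n \<le> R" using F by (simp add: R_def)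
  define a where "a S e = sign_vec S (fst e) * sign_vec S (snd e)" for S and e :: "nat \<times> nat"
  define p where "p e = edge_prob (fst e) (snd e)" for e
  define Bad1 where "Bad1 = {E. \<exists>S\<in>Pow {1..n}.
    \<bar>\<Sum>e\<in>node_pairs n. a S e * (of_bool (E e) - p e)\<bar> \<ge> 5 / 2 * (sqrt (real n * F) + real n)}"
  \<comment> \<open>Half of \<open>F\<close> bounds the expected number of edges, and the degree sum
    is twice that number; outside \<open>Bad2\<close> it is therefore below 100
    \<open>F\<close>.\<close>
  define Bad2 where "Bad2 = {E. (\<Sum>e\<in>node_pairs n. of_bool (E e)) \<ge> 100 * (F / 2)}"
  define Good where "Good = {A. \<forall>Y. solution n lam A Y \<longrightarrow>
    weighted_l1_norm n \<theta> (\<lambda>i j. Ystar i j - Y i j) \<le> 1111 / \<delta> * (1 + m * F) * R}"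
  have bad1: "measure_pmf.prob edge_law Bad1 \<le> 2 * (exp 1 / 2) powr (- 2 * real n)"
    unfolding Bad1_def edge_law_def p_def
    by (rule bernoulli_signs_deviation[OF finite_node_pairs edge_prob_pair _ sum_edge_prob_pairs F n_pos])
      (auto simp: a_def sign_vec_def card_Pow)
  have bad2: "measure_pmf.prob edge_law Bad2 \<le> 1 / 100"
    unfolding Bad2_def edge_law_def
    by (rule bernoulli_sum_markov[OF finite_node_pairs edge_prob_pair sum_edge_prob_pairs])
      (use F in auto)
  have "E \<in> adjacency -` Good" if E: "E \<in> set_pmf edge_law" "E \<notin> Bad1" "E \<notin> Bad2" for E
  proof -
    have K: "\<bar>quad_form n (noise (adjacency E)) x\<bar> \<le> 5 * R" if "x \<in> cube n" for x
    proof -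
      have "\<bar>quad_form n (noise (adjacency E)) x\<bar> \<le> 2 * (5 / 2 * R)"
        using E(2) by (intro noise_quad_form_bound[OF E(1) _ that])
          (auto simp: Bad1_def R_def a_def p_def not_le intro: less_imp_le)
      then show ?thesis by simp
    qed
    have D: "(\<Sum>i=1..n. degree n (adjacency E) i) \<le> 100 * F"
    proof -
      have "(\<Sum>i=1..n. degree n (adjacency E) i)
          = 2 * (\<Sum>(i, j)\<in>node_pairs n. adjacency E i j)"
        unfolding degree_def
        by (rule sum_node_pairs) (use adjacency_props[OF E(1)] in \<open>auto simp: symmetric_on_def\<close>)
      also have "(\<Sum>(i, j)\<in>node_pairs n. adjacency E i j) = (\<Sum>e\<in>node_pairs n. of_bool (E e))"
        using adjacency_props(4)[OF E(1)] by (intro sum.cong) auto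
      finally show ?thesis using E(3) by (simp add: Bad2_def)
    qed
    have "weighted_l1_norm n \<theta> (\<lambda>i j. Ystar i j - Y i j) \<le> 1111 / \<delta> * (1 + m * F) * R"
      if Y: "solution n lam (adjacency E) Y" for Y
    proof -
      have "\<delta> * weighted_l1_norm n \<theta> (\<lambda>i j. Ystar i j - Y i j)
          \<le> 100 * (5 * R) + lam * ((2 * (5 * R) + real n) * (100 * F + F))"
        by (rule deterministic_bound[OF \<delta> less_imp_le[OF lam] within between
              adjacency_props(1-3)[OF E(1)] K D Y]) auto
      \<comment> \<open>Since n <= R, the first factor is at most 11 \<open>R\<close>, and 11 * 101
        = 1111; the term 500 \<open>R\<close> is raised to the same constant so that it factors
        out.\<close>
      also have "\<dots> \<le> 1111 * R + m * ((11 * R) * (101 * F))"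
      proof (rule add_mono)
        have "0 \<le> R" using R by simp
        then show "100 * (5 * R) \<le> 1111 * R" by simp
        show "lam * ((2 * (5 * R) + real n) * (100 * F + F)) \<le> m * ((11 * R) * (101 * F))"
          using R \<open>0 \<le> R\<close> m lam F by (intro mult_mono) auto
      qed
      also have "\<dots> = 1111 * (1 + m * F) * R" by (simp add: algebra_simps)
      finally show ?thesis using \<delta> by (simp add: field_simps)
    qed
    then show ?thesis by (simp add: Good_def)
  qed
  then have sub: "set_pmf edge_law \<subseteq> adjacency -` Good \<union> (Bad1 \<union> Bad2)" by blast
  \<comment> \<open>The unit mass of the support is covered by the good event and the two bad ones;
    \<open>Bad2\<close> accounts for the loss of 0.01.\<close>
  have "1 = measure_pmf.prob edge_law (set_pmf edge_law)"
    by (simp add: measure_pmf.prob_eq_1 AE_measure_pmf)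
  also have "\<dots> \<le> measure_pmf.prob edge_law (adjacency -` Good \<union> (Bad1 \<union> Bad2))"
    by (rule measure_pmf.finite_measure_mono[OF sub]) simp
  also have "\<dots> \<le> measure_pmf.prob edge_law (adjacency -` Good)
      + measure_pmf.prob edge_law (Bad1 \<union> Bad2)"
    by (rule measure_Un_le) auto
  also have "measure_pmf.prob edge_law (Bad1 \<union> Bad2)
      \<le> measure_pmf.prob edge_law Bad1 + measure_pmf.prob edge_law Bad2"
    by (rule measure_Un_le) auto
  finally have "0.99 - 2 * (exp 1 / 2) powr (- 2 * real n)
      \<le> measure_pmf.prob (dcsbm n r C \<theta> B) Good"
    using bad1 bad2 by (simp add: dcsbm_eq)
  then show ?thesis unfolding Good_def m_def R_def .
qed

end

theorem theorem1:
  "\<exists>C0::real. 0 < C0 \<and>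
    (\<forall>(n::nat) (r::nat) (C :: nat \<Rightarrow> nat set) (\<theta> :: nat \<Rightarrow> real)
      (B :: nat \<Rightarrow> nat \<Rightarrow> real) (lam::real) (\<delta>::real).
      dcsbm_params n r C \<theta> B \<longrightarrow>
      max_between r (\<lambda>a b. B a b / (H r C \<theta> B a * H r C \<theta> B b))
        < min_within r (\<lambda>a. B a a / (H r C \<theta> B a)\<^sup>2) \<longrightarrow>
      0 < \<delta> \<longrightarrow>
      max_between r (\<lambda>a b. (B a b + \<delta>) / (H r C \<theta> B a * H r C \<theta> B b)) < lam \<longrightarrow>
      lam < min_within r (\<lambda>a. (B a a - \<delta>) / (H r C \<theta> B a)\<^sup>2) \<longrightarrow>
      measure_pmf.prob (dcsbm n r C \<theta> B)
        {A. \<forall>Y. solution n lam A Y \<longrightarrow>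
          weighted_l1_norm n \<theta> (\<lambda>i j. true_partition_matrix r C i j - Y i j)
            \<le> C0 / \<delta>
               * (1 + min_within r (\<lambda>a. B a a / (H r C \<theta> B a)\<^sup>2) * l1_norm n (f_vec r C \<theta> B))
               * (sqrt (real n * l1_norm n (f_vec r C \<theta> B)) + real n)}
        \<ge> 0.99 - 2 * (exp 1 / 2) powr (- 2 * real n))"
  by (intro exI[of _ 1111] conjI allI impI dcsbm_setting.recovery_bound dcsbm_setting.intro) simp_all

end
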